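(* Let $(X,d,A)$ be a metric pair with $A\neq\emptyset$ and assume that $X$ is locally compact. Let $T:\mathrm{Lip}_c(X,A)\to\mathbb{R}$ be a sequentially order continuous positive linear functional. Then there is a unique locally $1$-finite relative Radon measure $\mu\in\hat{\mathcal{M}}_1^+(X,A)$ such that $T(f)=\int_X f\,d\mu$ for all $f\in \mathrm{Lip}_c(X,A)$.
   Context: A metric pair $(X,d,A)$ is a metric space $(X,d)$ with a closed subset $A\subset X$; $d_A(x)=\inf_{a\in A}d(x,a)$. Measures take values in $[0,\infty]$. Let $\mathcal{B}^+(X)$ be the commutative monoid of Borel measures on $X$ and $\mathcal{B}^+(X,A)=\mathcal{B}^+(X)/\mathcal{B}^+(A)$ the quotient monoid: $\mu\sim\nu$ iff $\mu+\sigma=\nu+\tau$ for some Borel measures $\sigma,\tau$ concentrated on $A$. Equivalently, $\mu\sim\nu$ iff $\mu$ and $\nu$ agree on Borel subsets of $X\setminus A$, so elements of $\mathcal{B}^+(X,A)$ ("relative Borel measures") correspond bijectively to Borel measures on $X\setminus A$. For $f$ vanishing on $A$, $\mu(f)=\int_X f\,d\mu=\int_{X\setminus A}f\,d\mu$ is well defined. $\mu\in\mathcal{B}^+(X,A)$ is tight if $\mu(E)=\sup\{\mu(K): K\subset E \text{ compact}\}$ for every Borel $E\subset X\setminus A$. It is locally $1$-finite if each $x\in X$ (including $x\in A$) has a neighborhood $U$ with $\int_{U\setminus A}d_A\,d\mu<\infty$. $\hat{\mathcal{M}}_1^+(X,A)$ is the set of tight, locally $1$-finite $\mu\in\mathcal{B}^+(X,A)$.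 $\mathrm{Lip}_c(X,A)$ is the vector space of Lipschitz functions $f:X\to\mathbb{R}$ with $f|_A=0$ and compact support (in $X$), with the pointwise partial order; it is a Riesz space (vector lattice). A linear functional is positive if it is nonnegative on nonnegative elements. In a Riesz space $E$, $x_n\xrightarrow{o}0$ means there is a decreasing sequence $(y_n)$ in $E$ with infimum $0$ in $E$ and $|x_n|\le y_n$ for all $n$; a linear functional $T$ on $E$ is sequentially order continuous if $x_n\xrightarrow{o}0$ implies $T(x_n)\to0$. *)

theory Defs
  imports "HOL-Analysis.Analysis"
begin

section \<open>Relative Borel measures\<close>

text \<open>The metric space \<open>X\<close> is the whole type \<open>'a\<close>; \<open>A\<close> is a closed subset. Borel
  measures on \<open>A\<close> are identified with the Borel measures on \<open>X\<close> concentrated on \<open>A\<close>.\<close>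

definition borel_measures :: "'a::topological_space measure set" where
  "borel_measures = {\<mu>. sets \<mu> = sets borel}"

definition borel_measures_on :: "'a::topological_space set \<Rightarrow> 'a measure set" where
  "borel_measures_on A = {\<sigma> \<in> borel_measures. emeasure \<sigma> (- A) = 0}"

text \<open>\<open>\<mu> + \<sigma> = \<nu> + \<tau>\<close> is spelled out setwise, since the library has no addition on measures.\<close>

definition rel_measure_rel :: "'a::topological_space set \<Rightarrow> ('a measure \<times> 'a measure) set" where
  "rel_measure_rel A = {(\<mu>, \<nu>). \<mu> \<in> borel_measures \<and> \<nu> \<in> borel_measures \<and>
     (\<exists>\<sigma>\<in>borel_measures_on A. \<exists>\<tau>\<in>borel_measures_on A. \<forall>E\<in>sets borel.
        emeasure \<mu> E + emeasure \<sigma> E = emeasure \<nu> E + emeasure \<tau> E)}"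

definition rel_borel_measures :: "'a::topological_space set \<Rightarrow> 'a measure set set" where
  "rel_borel_measures A = borel_measures // rel_measure_rel A"

text \<open>Quantities attached to a class are computed on an arbitrary representative. They do not
  depend on its choice for Borel sets disjoint from \<open>A\<close> and for Borel functions vanishing
  on \<open>A\<close>; see \<open>rel_emeasure_eq\<close>, \<open>rel_nn_integral_eq\<close> and \<open>rel_integral_eq\<close> below.\<close>

definition rel_rep :: "'a measure set \<Rightarrow> 'a measure" where
  "rel_rep m = (SOME \<mu>. \<mu> \<in> m)"

definition rel_emeasure :: "'a measure set \<Rightarrow> 'a set \<Rightarrow> ennreal" where
  "rel_emeasure m E = emeasure (rel_rep m) E"

definition rel_nn_integral :: "'a measure set \<Rightarrow> ('a \<Rightarrow> ennreal) \<Rightarrow> ennreal" where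
  "rel_nn_integral m f = (\<integral>\<^sup>+ x. f x \<partial>(rel_rep m))"

definition rel_integral :: "'a measure set \<Rightarrow> ('a \<Rightarrow> real) \<Rightarrow> real" where
  "rel_integral m f = (\<integral> x. f x \<partial>(rel_rep m))"

definition rel_tight :: "'a::topological_space set \<Rightarrow> 'a measure set \<Rightarrow> bool" where
  "rel_tight A m \<longleftrightarrow> (\<forall>E\<in>sets borel. E \<subseteq> - A \<longrightarrow>
     rel_emeasure m E = (SUP K\<in>{K. compact K \<and> K \<subseteq> E}. rel_emeasure m K))"

definition locally_1_finite :: "'a::metric_space set \<Rightarrow> 'a measure set \<Rightarrow> bool" where
  "locally_1_finite A m \<longleftrightarrow> (\<forall>x. \<exists>U. open U \<and> x \<in> U \<and>
     rel_nn_integral m (\<lambda>y. ennreal (infdist y A) * indicator (U - A) y) < \<infinity>)"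

definition rel_radon_measures :: "'a::metric_space set \<Rightarrow> 'a measure set set" where
  "rel_radon_measures A = {m \<in> rel_borel_measures A. rel_tight A m \<and> locally_1_finite A m}"

section \<open>Lipschitz functions with compact support\<close>

definition Lip_c :: "'a::metric_space set \<Rightarrow> ('a \<Rightarrow> real) set" where
  "Lip_c A = {f. (\<exists>L. L-lipschitz_on UNIV f) \<and> (\<forall>x\<in>A. f x = 0) \<and> compact (closure {x. f x \<noteq> 0})}"

section \<open>Functionals on spaces of functions\<close>

text \<open>A functional on a space \<open>E\<close> of real functions is a total function on \<open>'a \<Rightarrow> real\<close>, of
  which only the values on \<open>E\<close> are constrained.\<close>

definition linear_functional_on :: "('a \<Rightarrow> real) set \<Rightarrow> (('a \<Rightarrow> real) \<Rightarrow> real) \<Rightarrow> bool" where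
  "linear_functional_on E T \<longleftrightarrow>
     (\<forall>f\<in>E. \<forall>g\<in>E. T (\<lambda>x. f x + g x) = T f + T g) \<and>
     (\<forall>c. \<forall>f\<in>E. T (\<lambda>x. c * f x) = c * T f)"

definition positive_functional_on :: "('a \<Rightarrow> real) set \<Rightarrow> (('a \<Rightarrow> real) \<Rightarrow> real) \<Rightarrow> bool" where
  "positive_functional_on E T \<longleftrightarrow> (\<forall>f\<in>E. (\<forall>x. 0 \<le> f x) \<longrightarrow> 0 \<le> T f)"

text \<open>The infimum is taken in \<open>E\<close>: the zero function is the greatest lower bound among the
  elements of \<open>E\<close>, which does not force pointwise convergence to \<open>0\<close>.\<close>

definition has_inf_zero_in :: "('a \<Rightarrow> real) set \<Rightarrow> (nat \<Rightarrow> 'a \<Rightarrow> real) \<Rightarrow> bool" where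
  "has_inf_zero_in E y \<longleftrightarrow> (\<forall>n. (\<lambda>_. 0) \<le> y n) \<and>
     (\<forall>g\<in>E. (\<forall>n. g \<le> y n) \<longrightarrow> g \<le> (\<lambda>_. 0))"

definition order_tendsto_zero :: "('a \<Rightarrow> real) set \<Rightarrow> (nat \<Rightarrow> 'a \<Rightarrow> real) \<Rightarrow> bool" where
  "order_tendsto_zero E x \<longleftrightarrow> (\<exists>y. (\<forall>n. y n \<in> E) \<and> decseq y \<and> has_inf_zero_in E y \<and>
     (\<forall>n. (\<lambda>p. \<bar>x n p\<bar>) \<le> y n))"

definition seq_order_continuous_on :: "('a \<Rightarrow> real) set \<Rightarrow> (('a \<Rightarrow> real) \<Rightarrow> real) \<Rightarrow> bool" where
  "seq_order_continuous_on E T \<longleftrightarrow>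
     (\<forall>x. (\<forall>n. x n \<in> E) \<longrightarrow> order_tendsto_zero E x \<longrightarrow> (\<lambda>n. T (x n)) \<longlonglongrightarrow> 0)"

section \<open>Well-definedness\<close>

lemma rel_measure_rel_iff:
  assumes "closed A"
  shows "(\<mu>, \<nu>) \<in> rel_measure_rel A \<longleftrightarrow> \<mu> \<in> borel_measures \<and> \<nu> \<in> borel_measures \<and>
    (\<forall>E\<in>sets borel. E \<subseteq> - A \<longrightarrow> emeasure \<mu> E = emeasure \<nu> E)" (is "?L \<longleftrightarrow> ?R")
proof
  assume ?L
  then obtain \<sigma> \<tau> where mb: "\<mu> \<in> borel_measures" "\<nu> \<in> borel_measures"
    and s: "sets \<sigma> = sets borel" "sets \<tau> = sets borel"
      "emeasure \<sigma> (- A) = 0" "emeasure \<tau> (- A) = 0"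
    and eq: "\<forall>E\<in>sets borel. emeasure \<mu> E + emeasure \<sigma> E = emeasure \<nu> E + emeasure \<tau> E"
    by (auto simp: rel_measure_rel_def borel_measures_on_def borel_measures_def)
  have A: "- A \<in> sets borel" using assms by auto
  have "emeasure \<mu> E = emeasure \<nu> E" if E: "E \<in> sets borel" "E \<subseteq> - A" for E
  proof -
    have "emeasure \<sigma> E = 0" "emeasure \<tau> E = 0"
      using emeasure_mono[of E "- A" \<sigma>] emeasure_mono[of E "- A" \<tau>] s A E by auto
    with eq E show ?thesis by (metis add.right_neutral)
  qed
  with mb show ?R by auto
next
  assume R: ?R
  then have sm: "sets \<mu> = sets borel" "sets \<nu> = sets borel"
    by (auto simp: borel_measures_def)
  have A: "A \<in> sets borel" using assms by auto
  define \<sigma> where "\<sigma> = density \<nu> (indicator A)"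
  define \<tau> where "\<tau> = density \<mu> (indicator A)"
  have A2: "A \<in> sets \<mu>" "A \<in> sets \<nu>" using A sm by auto
  have es: "emeasure \<sigma> E = emeasure \<nu> (A \<inter> E)" "emeasure \<tau> E = emeasure \<mu> (A \<inter> E)"
    if "E \<in> sets borel" for E
    using that A2 sm unfolding \<sigma>_def \<tau>_def
    by (subst emeasure_restricted; auto)+
  have "\<sigma> \<in> borel_measures_on A" "\<tau> \<in> borel_measures_on A"
    using es[of "- A"] A by (auto simp: borel_measures_on_def borel_measures_def \<sigma>_def \<tau>_def sm)
  moreover have "emeasure \<mu> E + emeasure \<sigma> E = emeasure \<nu> E + emeasure \<tau> E"
    if E: "E \<in> sets borel" for E
  proof -
    have split: "emeasure \<kappa> E = emeasure \<kappa> (A \<inter> E) + emeasure \<kappa> (E - A)"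
      if "sets \<kappa> = sets borel" for \<kappa> :: "'a measure"
      using that E A by (subst plus_emeasure) (auto intro!: arg_cong[where f="emeasure \<kappa>"])
    have "emeasure \<mu> (E - A) = emeasure \<nu> (E - A)"
      using R E A by auto
    then show ?thesis
      using split[OF sm(1)] split[OF sm(2)] es[OF E] by (simp add: ac_simps)
  qed
  ultimately show ?L using R unfolding rel_measure_rel_def by blast
qed

lemma equiv_rel_measure_rel:
  assumes "closed A"
  shows "equiv borel_measures (rel_measure_rel A)"
proof (rule equivI)
  show "rel_measure_rel A \<subseteq> borel_measures \<times> borel_measures"
    by (auto simp: rel_measure_rel_def)
  show "refl_on borel_measures (rel_measure_rel A)"
    using assms by (auto simp: refl_on_def rel_measure_rel_iff)
  show "sym (rel_measure_rel A)"
    using assms by (auto simp: sym_def rel_measure_rel_iff)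
  show "trans (rel_measure_rel A)"
    using assms by (auto simp: trans_def rel_measure_rel_iff)
qed

lemma rel_rep_equiv:
  assumes "closed A" "m \<in> rel_borel_measures A" "\<mu> \<in> m"
  shows "(rel_rep m, \<mu>) \<in> rel_measure_rel A"
proof -
  have "rel_rep m \<in> m"
    unfolding rel_rep_def using assms(3) by (rule someI)
  then show ?thesis
    using quotient_eq_iff[OF equiv_rel_measure_rel[OF assms(1)]] assms
    unfolding rel_borel_measures_def by blast
qed

lemma rel_emeasure_eq:
  assumes "closed A" "m \<in> rel_borel_measures A" "\<mu> \<in> m" "E \<in> sets borel" "E \<subseteq> - A"
  shows "rel_emeasure m E = emeasure \<mu> E"
  using rel_rep_equiv[OF assms(1-3)] assms
  by (auto simp: rel_measure_rel_iff rel_emeasure_def)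

lemma restrict_space_eq_if_equiv:
  assumes "closed A" "(\<mu>, \<nu>) \<in> rel_measure_rel A"
  shows "restrict_space \<mu> (- A) = restrict_space \<nu> (- A)"
proof (rule measure_eqI)
  have sm: "sets \<mu> = sets borel" "sets \<nu> = sets borel"
    using assms by (auto simp: rel_measure_rel_iff borel_measures_def)
  then show "sets (restrict_space \<mu> (- A)) = sets (restrict_space \<nu> (- A))"
    by (simp add: sets_restrict_space)
  have A: "- A \<in> sets borel" using assms(1) by auto
  have sp: "space \<mu> = UNIV" "space \<nu> = UNIV"
    using sm[THEN sets_eq_imp_space_eq] by simp_all
  fix E assume "E \<in> sets (restrict_space \<mu> (- A))"
  then have E: "E \<in> sets borel" "E \<subseteq> - A"
    using A by (simp_all add: sets_restrict_space_iff sm sp)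
  have "emeasure \<mu> E = emeasure \<nu> E"
    using assms E by (simp add: rel_measure_rel_iff)
  then show "emeasure (restrict_space \<mu> (- A)) E = emeasure (restrict_space \<nu> (- A)) E"
    using E A by (simp add: emeasure_restrict_space sm sp)
qed

lemma rel_nn_integral_eq:
  fixes f :: "'a::topological_space \<Rightarrow> ennreal"
  assumes "closed A" "m \<in> rel_borel_measures A" "\<mu> \<in> m" "\<And>x. x \<in> A \<Longrightarrow> f x = 0"
  shows "rel_nn_integral m f = (\<integral>\<^sup>+ x. f x \<partial>\<mu>)"
proof -
  have *: "(\<integral>\<^sup>+ x. f x \<partial>\<kappa>) = (\<integral>\<^sup>+ x. f x \<partial>(restrict_space \<kappa> (- A)))"
    if "sets \<kappa> = sets borel" for \<kappa>
    using assms(1,4) that sets_eq_imp_space_eq[OF that]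
    by (subst nn_integral_restrict_space) (auto intro!: nn_integral_cong simp: indicator_def)
  have r: "(rel_rep m, \<mu>) \<in> rel_measure_rel A"
    by (rule rel_rep_equiv[OF assms(1-3)])
  with *[of "rel_rep m"] *[of \<mu>] restrict_space_eq_if_equiv[OF assms(1) r] show ?thesis
    by (simp add: rel_nn_integral_def rel_measure_rel_def borel_measures_def)
qed

lemma rel_integral_eq:
  fixes f :: "'a::topological_space \<Rightarrow> real"
  assumes "closed A" "m \<in> rel_borel_measures A" "\<mu> \<in> m" "\<And>x. x \<in> A \<Longrightarrow> f x = 0"
  shows "rel_integral m f = (\<integral> x. f x \<partial>\<mu>)"
proof -
  have *: "(\<integral> x. f x \<partial>\<kappa>) = (\<integral> x. f x \<partial>(restrict_space \<kappa> (- A)))"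
    if "sets \<kappa> = sets borel" for \<kappa>
    using assms(1,4) that sets_eq_imp_space_eq[OF that]
    by (subst integral_restrict_space) (auto intro!: Bochner_Integration.integral_cong simp: indicator_def)
  have r: "(rel_rep m, \<mu>) \<in> rel_measure_rel A"
    by (rule rel_rep_equiv[OF assms(1-3)])
  with *[of "rel_rep m"] *[of \<mu>] restrict_space_eq_if_equiv[OF assms(1) r] show ?thesis
    by (simp add: rel_integral_def rel_measure_rel_def borel_measures_def)
qed

text \<open>The Bochner integral of a non-integrable function is \<open>0\<close> by convention; this convention
  is never used for functions in \<open>Lip_c A\<close> and locally 1-finite classes.\<close>

lemma integrable_Lip_c:
  fixes A :: "'a::metric_space set"
  assumes "closed A" "A \<noteq> {}" "m \<in> rel_borel_measures A" "locally_1_finite A m" "f \<in> Lip_c A"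
  shows "integrable (rel_rep m) f"
proof -
  obtain \<mu> where "\<mu> \<in> m"
    using assms(1,3) in_quotient_imp_non_empty[OF equiv_rel_measure_rel]
    unfolding rel_borel_measures_def by blast
  then have sm: "sets (rel_rep m) = sets borel"
    using rel_rep_equiv[OF assms(1,3)] by (auto simp: rel_measure_rel_def borel_measures_def)
  obtain L where L: "L-lipschitz_on UNIV f" and f0: "\<forall>x\<in>A. f x = 0"
    and K: "compact (closure {x. f x \<noteq> 0})"
    using assms(5) by (auto simp: Lip_c_def)
  have bnd: "norm (f x) \<le> L * infdist x A" for x
  proof -
    have "norm (f x) \<le> L * dist x a" if "a \<in> A" for a
      using lipschitz_onD[OF L, of x a] f0 that by (simp add: dist_real_def)
    moreover have "L \<ge> 0" using L by (rule lipschitz_on_nonneg)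
    ultimately show ?thesis
    proof (cases "L = 0")
      case True
      with \<open>\<And>a. a \<in> A \<Longrightarrow> norm (f x) \<le> L * dist x a\<close> assms(2) show ?thesis by auto
    next
      case False
      with \<open>L \<ge> 0\<close> have "L > 0" by simp
      have "norm (f x) / L \<le> infdist x A"
        unfolding infdist_notempty[OF assms(2)]
        using \<open>\<And>a. a \<in> A \<Longrightarrow> norm (f x) \<le> L * dist x a\<close> assms(2) \<open>L > 0\<close>
        by (intro cINF_greatest) (auto simp: field_simps)
      with \<open>L > 0\<close> show ?thesis by (simp add: field_simps)
    qed
  qed
  obtain U where U: "\<And>x. open (U x)" "\<And>x. x \<in> U x"
    "\<And>x. (\<integral>\<^sup>+ y. ennreal (infdist y A) * indicator (U x - A) y \<partial>(rel_rep m)) < \<infinity>"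
    using assms(4) unfolding locally_1_finite_def rel_nn_integral_def by metis
  obtain F where F: "finite F" "closure {x. f x \<noteq> 0} \<subseteq> (\<Union>x\<in>F. U x)"
    using compactE_image[OF K, of UNIV U] U(1,2) by (metis UNIV_I UN_I subsetI)
  have pw: "ennreal (norm (f y)) \<le>
      (\<Sum>x\<in>F. ennreal L * (ennreal (infdist y A) * indicator (U x - A) y))" for y
  proof (cases "f y = 0")
    case False
    then have "y \<in> closure {x. f x \<noteq> 0}" using closure_subset by fastforce
    then obtain x where x: "x \<in> F" "y \<in> U x" using F by auto
    have "y \<notin> A" using False f0 by auto
    then have "ennreal (norm (f y)) \<le> ennreal L * (ennreal (infdist y A) * indicator (U x - A) y)"
      using bnd[of y] x lipschitz_on_nonneg[OF L]
      by (simp add: ennreal_mult'[symmetric] ennreal_leI del: real_norm_def)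
    also have "\<dots> \<le> (\<Sum>x\<in>F. ennreal L * (ennreal (infdist y A) * indicator (U x - A) y))"
      using x F(1) by (intro member_le_sum) auto
    finally show ?thesis .
  qed simp
  have [measurable]: "(\<lambda>y. ennreal (infdist y A)) \<in> borel_measurable (rel_rep m)"
    unfolding measurable_cong_sets[OF sm refl]
    by (intro measurable_compose[OF _ measurable_ennreal] borel_measurable_continuous_onI
        continuous_intros)
  have [measurable]: "U x - A \<in> sets (rel_rep m)" for x
    using U(1) assms(1) by (simp add: sm)
  have fm: "f \<in> borel_measurable (rel_rep m)"
    unfolding measurable_cong_sets[OF sm refl]
    by (intro borel_measurable_continuous_onI lipschitz_on_continuous_on[OF L])
  have "(\<integral>\<^sup>+ y. ennreal (norm (f y)) \<partial>(rel_rep m)) \<le>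
      (\<integral>\<^sup>+ y. (\<Sum>x\<in>F. ennreal L * (ennreal (infdist y A) * indicator (U x - A) y)) \<partial>(rel_rep m))"
    by (intro nn_integral_mono pw)
  also have "\<dots> = (\<Sum>x\<in>F. ennreal L * (\<integral>\<^sup>+ y. ennreal (infdist y A) * indicator (U x - A) y \<partial>(rel_rep m)))"
    by (subst nn_integral_sum) (auto intro!: sum.cong nn_integral_cmult)
  also have "\<dots> < \<infinity>"
    using U(3) F(1) by (auto simp: ennreal_mult_less_top)
  finally show ?thesis
    using fm by (simp add: integrable_iff_bounded)
qed

end

theory Submission
  imports Defs
begin

text \<open>Order continuity gives the Daniell property \<open>T f \<le> (\<Sum>n. T (g n))\<close> whenever \<open>f \<le> (\<Sum>n. g n)\<close>
  pointwise with \<open>g n \<ge> 0\<close>. Hence the infimum of \<open>\<Sum>n. T (g n)\<close> over the countable covers \<open>g\<close> of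
  \<open>E - A\<close> by nonnegative functions is an outer measure \<open>outer E\<close> compatible with \<open>T\<close>, for which
  closed sets are Caratheodory measurable. Replacing it by the supremum of \<open>outer (E \<inter> K)\<close> over
  the compact sets \<open>K\<close> disjoint from \<open>A\<close> makes it tight without changing integrals of functions in
  \<open>Lip_c A\<close>, as these vanish off a \<open>\<sigma>\<close>-compact subset of \<open>- A\<close>. For uniqueness, the indicator of
  a compact set disjoint from \<open>A\<close> is a decreasing limit of functions in \<open>Lip_c A\<close>.\<close>

section \<open>Horizontal layers and a limit argument in \<open>ennreal\<close>\<close>

text \<open>Each summand is the slice of \<open>y\<close> between the heights \<open>k * s\<close>
  and \<open>(k + 1) * s\<close>; the first \<open>N\<close> slices stack up to the truncation of
  \<open>y\<close>.\<close>

lemma sum_min_layers: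
  fixes y s :: real
  assumes "0 \<le> s"
  shows "(\<Sum>k<N. min (max 0 (y - real k * s)) s) = min (max 0 y) (real N * s)"
proof (induction N)
  case (Suc N)
  have "0 \<le> real N * s" "real (Suc N) * s = real N * s + s"
    using assms by (simp_all add: algebra_simps)
  moreover have "min (max 0 y) p + min (max 0 (y - p)) s = min (max 0 y) (p + s)" if "0 \<le> p" for p
    using that assms by (auto simp: min_def max_def)
  ultimately show ?case using Suc by simp
qed simp

text \<open>Let \<open>r\<close> decrease to 1; an infinite \<open>t\<close> makes the bound
  trivial.\<close>

lemma ennreal_le_add_cmultI:
  fixes x s t :: ennreal
  assumes "\<And>r. 1 < r \<Longrightarrow> x \<le> s + ennreal r * t"
  shows "x \<le> s + t"
proof (cases t)
  case (real a)
  show ?thesis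
  proof (rule ennreal_le_epsilon)
    fix e :: real assume e: "0 < e"
    \<comment> \<open>With \<open>r - 1 = e / (a + 1)\<close> the excess \<open>(r - 1) * a\<close>
      is at most \<open>e\<close>; adding 1 to \<open>a\<close> avoids division by zero.\<close>
    have "x \<le> s + ennreal (1 + e / (a + 1)) * t"
      using real e by (intro assms) simp
    also have "ennreal (1 + e / (a + 1)) * t = ennreal (a + e * (a / (a + 1)))"
      using real e by (simp add: distrib_right flip: ennreal_mult)
    also have "\<dots> \<le> ennreal (a + e)"
      using real e by (intro ennreal_leI add_left_mono mult_left_le) auto
    also have "\<dots> = t + ennreal e"
      using real e by simp
    finally show "x \<le> s + t + ennreal e"
      by (simp add: add.assoc add_left_mono)
  qed
qed simp

section \<open>The lattice of compactly supported Lipschitz functions\<close>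

lemma compact_closure_subset:
  fixes S :: "'a::metric_space set"
  assumes "compact (closure S)" "R \<subseteq> S"
  shows "compact (closure R)"
  using closed_Int_compact[OF closed_closure assms(1), of R] closure_mono[OF assms(2)]
  by (simp add: Int_absorb2)

lemma Lip_c_lipschitz:
  assumes "f \<in> Lip_c A"
  obtains L where "L-lipschitz_on UNIV f"
  using assms by (auto simp: Lip_c_def)

lemma Lip_c_zero_on: "f \<in> Lip_c A \<Longrightarrow> x \<in> A \<Longrightarrow> f x = 0"
  by (simp add: Lip_c_def)

lemma Lip_c_continuous: "f \<in> Lip_c A \<Longrightarrow> continuous_on UNIV f"
  by (auto elim!: Lip_c_lipschitz intro: lipschitz_on_continuous_on)

lemma Lip_c_borel_measurable: "f \<in> Lip_c A \<Longrightarrow> f \<in> borel_measurable borel"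
  by (intro borel_measurable_continuous_onI Lip_c_continuous)

text \<open>Zeros pass from \<open>f\<close> to \<open>h\<close>, and with them the vanishing on
  \<open>A\<close> and the compact support; only the Lipschitz bound is left to check.\<close>

lemma Lip_c_dominated:
  assumes "f \<in> Lip_c A" "L-lipschitz_on UNIV h" "\<And>x. f x = 0 \<Longrightarrow> h x = 0"
  shows "h \<in> Lip_c A"
proof -
  have "compact (closure {x. h x \<noteq> 0})"
    by (rule compact_closure_subset[of "{x. f x \<noteq> 0}"]) (use assms in \<open>auto simp: Lip_c_def\<close>)
  then show ?thesis
    using assms by (auto simp: Lip_c_def)
qed

lemma Lip_c_bounded:
  assumes "f \<in> Lip_c A"
  obtains B where "0 < B" "\<And>x. \<bar>f x\<bar> \<le> B"
proof -
  let ?S = "closure {x. f x \<noteq> 0}"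
  have "compact (f ` ?S)"
    using assms Lip_c_continuous[OF assms]
    by (intro compact_continuous_image) (auto simp: Lip_c_def intro: continuous_on_subset)
  then obtain B where B: "0 < B" "\<And>y. y \<in> f ` ?S \<Longrightarrow> \<bar>y\<bar> \<le> B"
    using compact_imp_bounded bounded_pos by (metis real_norm_def)
  have "\<bar>f x\<bar> \<le> B" for x
    using B closure_subset[of "{x. f x \<noteq> 0}"] by (cases "f x = 0") auto
  with B(1) show ?thesis by (rule that)
qed

lemma Lip_c_add:
  assumes "f \<in> Lip_c A" "g \<in> Lip_c A"
  shows "(\<lambda>x. f x + g x) \<in> Lip_c A"
proof -
  obtain L M where "L-lipschitz_on UNIV f" "M-lipschitz_on UNIV g"
    using assms Lip_c_lipschitz by metis
  then have "(L + M)-lipschitz_on UNIV (\<lambda>x. f x + g x)"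
    by (rule lipschitz_on_add)
  moreover have "compact (closure {x. f x + g x \<noteq> 0})"
    by (rule compact_closure_subset[of "{x. f x \<noteq> 0} \<union> {x. g x \<noteq> 0}"])
      (use assms in \<open>auto simp: Lip_c_def\<close>)
  ultimately show ?thesis
    using assms by (auto simp: Lip_c_def)
qed

lemma Lip_c_cmult:
  assumes "f \<in> Lip_c A"
  shows "(\<lambda>x. c * f x) \<in> Lip_c A"
  using assms by (elim Lip_c_lipschitz) (rule Lip_c_dominated[OF assms], rule lipschitz_on_cmult_real, auto)

lemma Lip_c_diff:
  assumes "f \<in> Lip_c A" "g \<in> Lip_c A"
  shows "(\<lambda>x. f x - g x) \<in> Lip_c A"
  using Lip_c_add[OF assms(1) Lip_c_cmult[OF assms(2), of "-1"]] by simp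

lemma Lip_c_zero: "(\<lambda>_. 0) \<in> Lip_c A"
  by (auto simp: Lip_c_def intro!: exI[of _ 0] lipschitz_on_constant)

lemma Lip_c_sum:
  assumes "\<And>n. n \<in> I \<Longrightarrow> g n \<in> Lip_c A"
  shows "(\<lambda>x. \<Sum>n\<in>I. g n x) \<in> Lip_c A"
  using assms by (induction I rule: infinite_finite_induct) (auto simp: Lip_c_zero Lip_c_add)

text \<open>Supplies the lattice operations: positive part, absolute value and truncation are
  1-Lipschitz functions of the value that fix 0.\<close>

lemma Lip_c_compose:
  assumes f: "f \<in> Lip_c A" and \<psi>: "\<And>a b. \<bar>\<psi> a - \<psi> b\<bar> \<le> \<bar>a - b\<bar>" "\<psi> 0 = (0::real)"
  shows "(\<lambda>x. \<psi> (f x)) \<in> Lip_c A"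
proof -
  obtain L where L: "L-lipschitz_on UNIV f" using f by (rule Lip_c_lipschitz)
  have "1-lipschitz_on UNIV \<psi>"
    using \<psi>(1) by (auto intro!: lipschitz_onI simp: dist_real_def)
  then have "(1 * L)-lipschitz_on UNIV (\<lambda>x. \<psi> (f x))"
    using L by (intro lipschitz_on_compose2) (auto intro: lipschitz_on_subset)
  then show ?thesis
    using \<psi>(2) by (auto intro: Lip_c_dominated[OF f])
qed

text \<open>A product of Lipschitz functions is Lipschitz if both are bounded; \<open>f\<close> is
  bounded because its support is compact.\<close>

lemma Lip_c_mult:
  assumes f: "f \<in> Lip_c A" and h: "M-lipschitz_on UNIV h" "\<And>x. \<bar>h x\<bar> \<le> (1::real)"
  shows "(\<lambda>x. f x * h x) \<in> Lip_c A"
proof -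
  obtain L where L: "L-lipschitz_on UNIV f" using f by (rule Lip_c_lipschitz)
  obtain B where B: "0 < B" "\<And>x. \<bar>f x\<bar> \<le> B" using f Lip_c_bounded by blast
  have "(L + B * M)-lipschitz_on UNIV (\<lambda>x. f x * h x)"
  proof (rule lipschitz_onI)
    fix x y
    have "\<bar>f x * h x - f y * h y\<bar> = \<bar>(f x - f y) * h x + f y * (h x - h y)\<bar>"
      by (simp add: algebra_simps)
    also have "\<dots> \<le> \<bar>f x - f y\<bar> * \<bar>h x\<bar> + \<bar>f y\<bar> * \<bar>h x - h y\<bar>"
      by (metis abs_mult abs_triangle_ineq)
    also have "\<dots> \<le> (L * dist x y) * 1 + B * (M * dist x y)"
      using lipschitz_onD[OF L, of x y] lipschitz_onD[OF h(1), of x y] h(2)[of x] B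
      by (intro add_mono mult_mono) (auto simp: dist_real_def intro: mult_nonneg_nonneg lipschitz_on_nonneg[OF L])
    finally show "dist (f x * h x) (f y * h y) \<le> (L + B * M) * dist x y"
      by (simp add: dist_real_def algebra_simps)
  qed (use B lipschitz_on_nonneg[OF L] lipschitz_on_nonneg[OF h(1)] in auto)
  then show ?thesis by (auto intro: Lip_c_dominated[OF f])
qed

lemma lipschitz_on_min_cmult_infdist:
  assumes "0 \<le> k"
  shows "k-lipschitz_on UNIV (\<lambda>x. min 1 (k * infdist x C))"
proof (rule lipschitz_onI)
  fix x y :: 'a
  have "\<bar>k * infdist x C - k * infdist y C\<bar> \<le> k * dist x y"
    using mult_left_mono[OF infdist_triangle_abs[of x C y] assms] assms
    by (simp add: abs_mult flip: right_diff_distrib)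
  then show "dist (min 1 (k * infdist x C)) (min 1 (k * infdist y C)) \<le> k * dist x y"
    by (auto simp: dist_real_def)
qed fact

lemma Lip_c_support_bound:
  assumes L: "L-lipschitz_on UNIV f" and K: "compact K" "K \<inter> A = {}"
    and f: "\<And>x. x \<notin> K \<Longrightarrow> f x = (0::real)"
  shows "f \<in> Lip_c A"
proof -
  have "compact (closure {x. f x \<noteq> 0})"
  proof (rule compact_closure_subset)
    show "compact (closure K)" using K(1) by (simp add: closure_closed compact_imp_closed)
  qed (use f in auto)
  with L K f show ?thesis by (auto simp: Lip_c_def)
qed

section \<open>Cut-off functions around compact sets\<close>

text \<open>Local compactness gives an open \<open>V\<close> around \<open>K\<close> inside a
  compact \<open>C\<close>; compactness of \<open>K\<close> gives one radius for which all balls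
  centred in \<open>K\<close> stay in \<open>U\<close> and \<open>V\<close>.\<close>

lemma compact_neighbourhood_infdist:
  fixes K :: "'a::metric_space set"
  assumes lc: "locally_compact_space (euclidean :: 'a topology)" and K: "compact K" "K \<noteq> {}"
    and U: "open U" "K \<subseteq> U"
  obtains \<delta> where "0 < \<delta>" "compact {x. infdist x K \<le> \<delta>}" "{x. infdist x K \<le> \<delta>} \<subseteq> U"
proof -
  have "Hausdorff_space (euclidean :: 'a topology)"
    by (simp add: Hausdorff_space_euclidean)
  then obtain V C where V: "open V" "compact C" "K \<subseteq> V" "V \<subseteq> C"
    using lc K(1) locally_compact_space_compact_closed_compact[of "euclidean :: 'a topology"]
    by (auto simp: compactin_euclidean_iff)
  obtain e where e: "0 < e" "(\<Union>x\<in>K. ball x e) \<subseteq> U \<inter> V"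
    using compact_subset_open_imp_ball_epsilon_subset[of K "U \<inter> V"] K U V by auto
  \<comment> \<open>Halving \<open>e\<close> gives strict room: a distance of at most
    \<open>e / 2\<close> yields a point of \<open>K\<close> closer than \<open>e\<close>.\<close>
  have sub: "{x. infdist x K \<le> e / 2} \<subseteq> U \<inter> V"
  proof safe
    fix x assume "infdist x K \<le> e / 2"
    then have "\<not> e \<le> infdist x K"
      using e(1) by simp
    then obtain a where "a \<in> K" "dist x a < e"
      unfolding infdist_notempty[OF K(2)] using cINF_greatest[OF K(2)] by (meson not_le)
    then have "x \<in> (\<Union>x\<in>K. ball x e)"
      by (auto simp: dist_commute)
    with e(2) have "x \<in> U \<inter> V" by (rule subsetD)
    then show "x \<in> U" "x \<in> V" by simp_all
  qed
  have "closed {x. infdist x K \<le> e / 2}"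
    by (intro closed_Collect_le continuous_intros)
  then have "compact (C \<inter> {x. infdist x K \<le> e / 2})"
    by (rule compact_Int_closed[OF V(2)])
  moreover have "C \<inter> {x. infdist x K \<le> e / 2} = {x. infdist x K \<le> e / 2}"
    using sub V(4) by blast
  ultimately have "compact {x. infdist x K \<le> e / 2}"
    by (simp only:)
  with e(1) sub show ?thesis by (intro that[of "e / 2"]) auto
qed

text \<open>Slope \<open>1 / d\<close> makes the bump vanish beyond distance \<open>d\<close> from
  \<open>K\<close>, where the \<open>d\<close>-neighbourhood is compact and misses \<open>A\<close>.
  Steeper bumps are smaller, so one \<open>k\<close> serves all \<open>n\<close>.\<close>

lemma Lip_c_bump:
  fixes K A :: "'a::metric_space set"
  assumes lc: "locally_compact_space (euclidean :: 'a topology)" and A: "closed A"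
    and K: "compact K" "K \<noteq> {}" "K \<inter> A = {}"
  obtains k where "0 < k"
    "\<And>n::nat. (\<lambda>x. max 0 (1 - (k + real n) * infdist x K)) \<in> Lip_c A"
proof -
  obtain d where d: "0 < d" "compact {x. infdist x K \<le> d}" "{x. infdist x K \<le> d} \<subseteq> - A"
    by (rule compact_neighbourhood_infdist[OF lc K(1,2), of "- A"]) (use A K in auto)
  have "(\<lambda>x. max 0 (1 - (1 / d + real n) * infdist x K)) \<in> Lip_c A" for n
  proof (rule Lip_c_support_bound[OF _ d(2)])
    let ?k = "1 / d + real n"
    show "?k-lipschitz_on UNIV (\<lambda>x. max 0 (1 - ?k * infdist x K))"
    proof (rule lipschitz_onI)
      have k: "0 \<le> ?k" using d(1) by simp
      then show "0 \<le> ?k" .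
      fix x y
      have "\<bar>?k * infdist x K - ?k * infdist y K\<bar> \<le> ?k * dist x y"
        using mult_left_mono[OF infdist_triangle_abs[of x K y] k] k
        by (simp only: abs_mult abs_of_nonneg flip: right_diff_distrib)
      then show "dist (max 0 (1 - ?k * infdist x K)) (max 0 (1 - ?k * infdist y K)) \<le> ?k * dist x y"
        unfolding dist_real_def by linarith
    qed
    fix x assume "x \<notin> {x. infdist x K \<le> d}"
    then have "d < infdist x K" by simp
    then have "1 < (1 / d) * infdist x K" using d(1) by (simp add: field_simps)
    also have "\<dots> \<le> ?k * infdist x K" by (intro mult_right_mono infdist_nonneg) simp
    finally show "max 0 (1 - ?k * infdist x K) = 0" by simp
  qed (use d(3) in auto)
  with d(1) show ?thesis by (intro that[of "1 / d"]) auto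
qed

section \<open>The outer measure of a functional\<close>

locale Lip_c_functional =
  fixes A :: "'a::metric_space set"
    and T :: "('a \<Rightarrow> real) \<Rightarrow> real"
  assumes closed_A: "closed A"
    and locally_compact: "locally_compact_space (euclidean :: 'a topology)"
    and linear: "linear_functional_on (Lip_c A) T"
    and positive: "positive_functional_on (Lip_c A) T"
    and order_continuous: "seq_order_continuous_on (Lip_c A) T"
begin

section \<open>Linearity, positivity and order continuity of \<open>T\<close>\<close>

lemma T_add: "f \<in> Lip_c A \<Longrightarrow> g \<in> Lip_c A \<Longrightarrow> T (\<lambda>x. f x + g x) = T f + T g"
  and T_cmult: "f \<in> Lip_c A \<Longrightarrow> T (\<lambda>x. c * f x) = c * T f"
  using linear by (auto simp: linear_functional_on_def)

lemma T_diff: "f \<in> Lip_c A \<Longrightarrow> g \<in> Lip_c A \<Longrightarrow> T (\<lambda>x. f x - g x) = T f - T g"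
  using T_add[of f "\<lambda>x. -1 * g x"] T_cmult[of g "-1"] Lip_c_cmult[of g A "-1"] by simp

lemma T_zero: "T (\<lambda>_. 0) = 0"
  using T_cmult[OF Lip_c_zero, of 0] by simp

lemma T_sum: "(\<And>n. n \<in> I \<Longrightarrow> g n \<in> Lip_c A) \<Longrightarrow> T (\<lambda>x. \<Sum>n\<in>I. g n x) = (\<Sum>n\<in>I. T (g n))"
  by (induction I rule: infinite_finite_induct) (auto simp: T_zero T_add Lip_c_sum)

lemma T_nonneg: "f \<in> Lip_c A \<Longrightarrow> (\<And>x. 0 \<le> f x) \<Longrightarrow> 0 \<le> T f"
  using positive by (auto simp: positive_functional_on_def)

lemma T_mono: "f \<in> Lip_c A \<Longrightarrow> g \<in> Lip_c A \<Longrightarrow> (\<And>x. f x \<le> g x) \<Longrightarrow> T f \<le> T g"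
  using T_nonneg[of "\<lambda>x. g x - f x"] by (simp add: T_diff Lip_c_diff)

text \<open>Pointwise convergence to 0 makes every lower bound of the sequence nonpositive, so the
  infimum in \<open>Lip_c A\<close> is 0. Order continuity enters only through this lemma.\<close>

lemma T_tendsto_zero:
  assumes y: "\<And>n. y n \<in> Lip_c A" "\<And>n x. y (Suc n) x \<le> y n x" "\<And>x. (\<lambda>n. y n x) \<longlonglongrightarrow> 0"
  shows "(\<lambda>n. T (y n)) \<longlonglongrightarrow> 0"
proof -
  have dec: "decseq y"
    by (rule decseq_SucI) (simp add: le_fun_def y(2))
  have nonneg: "0 \<le> y n x" for n x
    by (rule decseq_ge[OF decseq_SucI y(3)]) (rule y(2))
  have "g \<le> (\<lambda>_. 0)" if "\<forall>n. g \<le> y n" for g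
    using that by (auto simp: le_fun_def intro!: LIMSEQ_le_const[OF y(3)])
  then have "has_inf_zero_in (Lip_c A) y"
    using nonneg by (auto simp: has_inf_zero_in_def le_fun_def)
  then have "order_tendsto_zero (Lip_c A) y"
    unfolding order_tendsto_zero_def using y(1) dec nonneg by (intro exI[of _ y]) auto
  then show ?thesis
    using order_continuous y(1) by (auto simp: seq_order_continuous_on_def)
qed

lemma T_le_suminf:
  assumes f: "f \<in> Lip_c A"
    and g: "\<And>n. g n \<in> Lip_c A" "\<And>n x. 0 \<le> g n x"
    and le: "\<And>x. ennreal (f x) \<le> (\<Sum>n. ennreal (g n x))"
  shows "ennreal (T f) \<le> (\<Sum>n. ennreal (T (g n)))"
proof -
  define s where "s N x = (\<Sum>n<N. g n x)" for N x
  \<comment> \<open>The part of \<open>f\<close> missed by the first \<open>N\<close> terms; it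
    decreases to 0, and \<open>f \<le> y N + s N\<close>.\<close>
  define y where "y N x = max 0 (f x - s N x)" for N x
  have s: "s N \<in> Lip_c A" for N
    unfolding s_def by (intro Lip_c_sum g)
  have y: "y N \<in> Lip_c A" for N
    unfolding y_def by (rule Lip_c_compose[OF Lip_c_diff[OF f s]]) auto
  have "(\<lambda>N. T (y N)) \<longlonglongrightarrow> 0"
  proof (rule T_tendsto_zero[OF y])
    show "y (Suc N) x \<le> y N x" for N x
      using g(2)[of N x] by (simp add: y_def s_def)
    fix x
    \<comment> \<open>Truncated subtraction in \<open>ennreal\<close> also handles points where the
      series diverges.\<close>
    have eq: "ennreal (y N x) = ennreal (f x) - (\<Sum>n<N. ennreal (g n x))" for N
      using g(2) by (simp add: y_def s_def sum_nonneg ennreal_minus ennreal_max_0)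
    have "(\<lambda>N. ennreal (f x) - (\<Sum>n<N. ennreal (g n x))) \<longlonglongrightarrow> ennreal (f x) - (\<Sum>n. ennreal (g n x))"
      by (rule tendsto_diff_ennreal_general[OF tendsto_const summable_LIMSEQ]) simp_all
    then have "(\<lambda>N. ennreal (y N x)) \<longlonglongrightarrow> ennreal 0"
      using le[of x] by (simp add: eq diff_eq_0_ennreal)
    then show "(\<lambda>N. y N x) \<longlonglongrightarrow> 0"
      by (subst (asm) tendsto_ennreal_iff) (auto simp: y_def)
  qed
  then have "(\<lambda>N. ennreal (T (y N)) + (\<Sum>n<N. ennreal (T (g n)))) \<longlonglongrightarrow> ennreal 0 + (\<Sum>n. ennreal (T (g n)))"
    by (intro tendsto_add tendsto_ennrealI summable_LIMSEQ) auto
  moreover have "ennreal (T f) \<le> ennreal (T (y N)) + (\<Sum>n<N. ennreal (T (g n)))" for N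
  proof -
    have "T f \<le> T (\<lambda>x. y N x + s N x)"
      by (intro T_mono f Lip_c_add y s) (simp add: y_def)
    also have "\<dots> = T (y N) + (\<Sum>n<N. T (g n))"
      using T_sum[of "{..<N}" g, OF g(1)] by (simp add: T_add y s) (simp add: s_def[abs_def])
    finally show ?thesis
      using T_nonneg[OF g] T_nonneg[OF y] by (simp add: y_def sum_nonneg ennreal_leI flip: ennreal_plus)
  qed
  ultimately show ?thesis
    by (intro LIMSEQ_le_const[of _ _ "ennreal (T f)"]) auto
qed

section \<open>Countable covers and the outer measure\<close>

definition covers :: "'a set \<Rightarrow> (nat \<Rightarrow> 'a \<Rightarrow> real) set" where
  "covers E = {g. (\<forall>n. g n \<in> Lip_c A) \<and> (\<forall>n x. 0 \<le> g n x) \<and>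
     (\<forall>x\<in>E - A. 1 \<le> (\<Sum>n. ennreal (g n x)))}"

text \<open>Points of \<open>A\<close> need not be covered, so that \<open>A\<close> becomes a null set; sets without a
  cover have outer measure \<open>\<infinity>\<close>.\<close>

definition outer :: "'a set \<Rightarrow> ennreal" where
  "outer E = (INF g\<in>covers E. \<Sum>n. ennreal (T (g n)))"

lemma covers_antimono: "E \<subseteq> F \<Longrightarrow> covers F \<subseteq> covers E"
  by (auto simp: covers_def)

lemma outer_mono: "E \<subseteq> F \<Longrightarrow> outer E \<le> outer F"
  unfolding outer_def by (intro INF_superset_mono covers_antimono order_refl)

lemma outer_le: "g \<in> covers E \<Longrightarrow> outer E \<le> (\<Sum>n. ennreal (T (g n)))"
  unfolding outer_def by (rule INF_lower)

text \<open>A doubly indexed cover becomes a sequence through \<open>prod_decode\<close>; double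
  series of nonnegative terms may be rearranged.\<close>

lemma outer_le_double:
  assumes g: "\<And>n k. g n k \<in> Lip_c A" "\<And>n k x. 0 \<le> g n k x"
    and cover: "\<And>x. x \<in> E \<Longrightarrow> x \<notin> A \<Longrightarrow> 1 \<le> (\<Sum>n. \<Sum>k. ennreal (g n k x))"
  shows "outer E \<le> (\<Sum>n. \<Sum>k. ennreal (T (g n k)))"
proof -
  let ?h = "\<lambda>i. case prod_decode i of (n, k) \<Rightarrow> g n k"
  have "(\<Sum>i. ennreal (?h i x)) = (\<Sum>n. \<Sum>k. ennreal (g n k x))" for x
    using suminf_ennreal_2dimen[of "\<lambda>n. \<Sum>k. ennreal (g n k x)" "\<lambda>(n, k). ennreal (g n k x)"]
    by (simp add: case_prod_unfold)
  moreover have "(\<Sum>i. ennreal (T (?h i))) = (\<Sum>n. \<Sum>k. ennreal (T (g n k)))"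
    using suminf_ennreal_2dimen[of "\<lambda>n. \<Sum>k. ennreal (T (g n k))" "\<lambda>(n, k). ennreal (T (g n k))"]
    by (simp add: case_prod_unfold)
  ultimately show ?thesis
    using g cover outer_le[of ?h E] by (simp add: covers_def case_prod_unfold)
qed

lemma outer_le_T:
  assumes h: "h \<in> Lip_c A" "\<And>x. 0 \<le> h x" "\<And>x. x \<in> E \<Longrightarrow> x \<notin> A \<Longrightarrow> 1 \<le> h x"
  shows "outer E \<le> ennreal (T h)"
proof -
  \<comment> \<open>The single function \<open>h\<close>, padded with zeros to a sequence.\<close>
  let ?g = "\<lambda>n::nat. if n = 0 then h else (\<lambda>_. 0)"
  have *: "(\<Sum>n. if n = 0 then a else 0) = a" for a :: ennreal
    by (subst suminf_finite[of "{0}"]) auto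
  have "?g \<in> covers E"
    using h by (auto simp: covers_def Lip_c_zero if_distrib if_distribR * cong: if_cong)
  from outer_le[OF this] show ?thesis
    by (simp add: if_distrib T_zero * cong: if_cong)
qed

text \<open>Every cover dominates \<open>h\<close>: on \<open>E - A\<close> because
  \<open>h \<le> 1\<close>, elsewhere because \<open>h \<le> 0\<close>. The Daniell property
  \<open>T_le_suminf\<close> transfers this to \<open>T\<close>.\<close>

lemma T_le_outer:
  assumes h: "h \<in> Lip_c A" "\<And>x. h x \<le> 1" "\<And>x. x \<notin> E \<Longrightarrow> h x \<le> 0"
  shows "ennreal (T h) \<le> outer E"
  unfolding outer_def
proof (rule INF_greatest)
  fix g assume g: "g \<in> covers E"
  have "ennreal (h x) \<le> (\<Sum>n. ennreal (g n x))" for x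
  proof (cases "x \<in> E - A")
    case True
    then have "ennreal (h x) \<le> 1" "1 \<le> (\<Sum>n. ennreal (g n x))"
      using g h(2)[of x] by (auto simp: covers_def ennreal_le_1)
    then show ?thesis by (rule order_trans)
  next
    case False
    then have "h x \<le> 0" using h(3) Lip_c_zero_on[OF h(1)] by auto
    then show ?thesis by (simp add: ennreal_neg)
  qed
  then show "ennreal (T h) \<le> (\<Sum>n. ennreal (T (g n)))"
    using g by (intro T_le_suminf h(1)) (auto simp: covers_def)
qed

lemma outer_empty: "outer {} = 0"
  using outer_le_T[OF Lip_c_zero, of "{}"] by (simp add: T_zero)

lemma outer_countably_subadditive: "outer (\<Union>i. E i) \<le> (\<Sum>i. outer (E i))"
proof (rule ennreal_le_epsilon)
  fix e :: real assume e: "0 < e" and fin: "(\<Sum>i. outer (E i)) < top"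
  \<comment> \<open>Nearly optimal covers, with errors that sum to \<open>e\<close>.\<close>
  have "\<exists>g\<in>covers (E i). (\<Sum>k. ennreal (T (g k))) < outer (E i) + ennreal (e * (1/2) ^ Suc i)" for i
    using e ennreal_suminf_lessD[OF fin, of i] by (intro INF_approx_ennreal outer_def) auto
  then obtain g where g: "\<And>i. g i \<in> covers (E i)"
    and le: "\<And>i. (\<Sum>k. ennreal (T (g i k))) < outer (E i) + ennreal (e * (1/2) ^ Suc i)"
    by metis
  have "outer (\<Union>i. E i) \<le> (\<Sum>i. \<Sum>k. ennreal (T (g i k)))"
  proof (rule outer_le_double)
    fix x assume "x \<in> (\<Union>i. E i)" "x \<notin> A"
    then obtain i where "x \<in> E i" "x \<notin> A" by auto
    then have "1 \<le> (\<Sum>k. ennreal (g i k x))"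
      using g[of i] by (auto simp: covers_def)
    also have "\<dots> \<le> (\<Sum>i. \<Sum>k. ennreal (g i k x))"
      using sum_le_suminf[of "\<lambda>i. \<Sum>k. ennreal (g i k x)" "{i}"] by simp
    finally show "1 \<le> (\<Sum>i. \<Sum>k. ennreal (g i k x))" .
  qed (use g in \<open>auto simp: covers_def\<close>)
  also have "\<dots> \<le> (\<Sum>i. outer (E i) + ennreal (e * (1/2) ^ Suc i))"
    by (intro suminf_le less_imp_le[OF le]) auto
  also have "\<dots> = (\<Sum>i. outer (E i)) + (\<Sum>i. ennreal e * ennreal ((1/2) ^ Suc i))"
    using e by (subst suminf_add[symmetric])
      (auto simp del: ennreal_suminf_cmult simp add: ennreal_mult[symmetric])
  also have "\<dots> = (\<Sum>i. outer (E i)) + ennreal e"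
    unfolding ennreal_suminf_cmult
    by (subst suminf_ennreal_eq[OF zero_le_power power_half_series]) auto
  finally show "outer (\<Union>i. E i) \<le> (\<Sum>i. outer (E i)) + ennreal e" .
qed

section \<open>Caratheodory measurability of Borel sets\<close>

lemma outer_measure_space_outer: "outer_measure_space (Pow UNIV) outer"
  unfolding outer_measure_space_def positive_def increasing_def countably_subadditive_def
  using outer_empty outer_mono outer_countably_subadditive by auto

text \<open>A cover \<open>g\<close> of \<open>E\<close> is split as \<open>g = g (1 - h k) + g (h k)\<close>, where the cut-offs \<open>h k\<close>
  vanish on \<open>C\<close> and increase to \<open>1\<close> off \<open>C\<close>. The functions \<open>g (1 - h k)\<close> cover \<open>E \<inter> C\<close>, and
  the increments \<open>g (h (k + 1) - h k)\<close>, taken together, cover \<open>E - C\<close>.\<close>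

lemma outer_split_closed:
  assumes C: "closed C"
  shows "outer (E \<inter> C) + outer (E - C) \<le> outer E"
proof (cases "C = {}")
  case True
  then show ?thesis by (simp add: outer_empty)
next
  case False
  define h where "h k x = min 1 (real k * infdist x C)" for k x
  have lip: "(real k)-lipschitz_on UNIV (h k)" for k
    unfolding h_def by (rule lipschitz_on_min_cmult_infdist) simp
  have h01: "0 \<le> h k x" "h k x \<le> 1" for k x
    by (simp_all add: h_def infdist_nonneg)
  have hmono: "h k x \<le> h (Suc k) x" for k x
    unfolding h_def by (intro min.mono mult_right_mono infdist_nonneg) simp_all
  have hC: "h k x = 0" if "x \<in> C" for k x
    using that by (simp add: h_def)
  \<comment> \<open>As \<open>C\<close> is closed, \<open>h k x\<close> is eventually 1 off
    \<open>C\<close>; since \<open>h 0 x = 0\<close>, the increments telescope to 1.\<close>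
  have h_sums: "(\<lambda>k. h (Suc k) x - h k x) sums 1" if "x \<notin> C" for x
  proof -
    have "0 < infdist x C"
      using that C False infdist_pos_not_in_closed by blast
    then obtain N :: nat where N: "1 < real N * infdist x C"
      using reals_Archimedean3 by blast
    have "h k x = 1" if "N \<le> k" for k
    proof -
      have "real N * infdist x C \<le> real k * infdist x C"
        using that by (intro mult_right_mono infdist_nonneg) simp
      with N show ?thesis by (simp add: h_def)
    qed
    then have "(\<lambda>k. h k x) \<longlonglongrightarrow> 1"
      by (intro tendsto_eventually) (auto simp: eventually_sequentially)
    from telescope_sums[OF this] show ?thesis by (simp add: h_def)
  qed
  show ?thesis
    unfolding outer_def[of E]
  proof (rule INF_greatest)
    fix g assume g: "g \<in> covers E"
    then have gL: "g n \<in> Lip_c A" and g0: "0 \<le> g n x" for n x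
      by (auto simp: covers_def)
    have gh: "(\<lambda>x. g n x * h k x) \<in> Lip_c A" for n k
      using h01 by (intro Lip_c_mult[OF gL lip]) simp
    define d where "d k n x = g n x * h (Suc k) x - g n x * h k x" for k n x
    have dL: "d k n \<in> Lip_c A" for k n
      unfolding d_def by (intro Lip_c_diff gh)
    have d0: "0 \<le> d k n x" for k n x
      using mult_left_mono[OF hmono g0] by (simp add: d_def)
    have "outer (E - C) \<le> (\<Sum>k. \<Sum>n. ennreal (T (d k n)))"
    proof (rule outer_le_double[OF dL d0])
      fix x assume x: "x \<in> E - C" "x \<notin> A"
      have "(\<Sum>n. ennreal (d k n x)) = (\<Sum>n. ennreal (g n x)) * ennreal (h (Suc k) x - h k x)" for k
        using g0 hmono by (simp add: d_def ennreal_mult flip: right_diff_distrib)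
      then have "(\<Sum>k. \<Sum>n. ennreal (d k n x)) =
          (\<Sum>n. ennreal (g n x)) * (\<Sum>k. ennreal (h (Suc k) x - h k x))"
        by simp
      also have "(\<Sum>k. ennreal (h (Suc k) x - h k x)) = ennreal 1"
        using x hmono by (intro suminf_ennreal_eq h_sums) simp_all
      finally show "1 \<le> (\<Sum>k. \<Sum>n. ennreal (d k n x))"
        using g x by (simp add: covers_def)
    qed
    \<comment> \<open>For each finite \<open>K\<close> the increments telescope to
      \<open>g n * h K\<close>, and the remainder \<open>g n * (1 - h K)\<close> covers
      \<open>E \<inter> C\<close>. Then \<open>K\<close> tends to infinity.\<close>
    moreover have "outer (E \<inter> C) + (\<Sum>k. \<Sum>n. ennreal (T (d k n))) \<le> (\<Sum>n. ennreal (T (g n)))"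
    proof (rule LIMSEQ_le_const2)
      show "(\<lambda>K. outer (E \<inter> C) + (\<Sum>k<K. \<Sum>n. ennreal (T (d k n))))
          \<longlonglongrightarrow> outer (E \<inter> C) + (\<Sum>k. \<Sum>n. ennreal (T (d k n)))"
        by (intro tendsto_add tendsto_const summable_LIMSEQ) simp
      have "outer (E \<inter> C) + (\<Sum>k<K. \<Sum>n. ennreal (T (d k n))) \<le> (\<Sum>n. ennreal (T (g n)))" for K
      proof -
        have T_d: "T (d k n) = T (\<lambda>x. g n x * h (Suc k) x) - T (\<lambda>x. g n x * h k x)" for k n
          unfolding d_def by (intro T_diff gh)
        have gh0: "0 \<le> T (\<lambda>x. g n x * h k x)" for n k
          using gh g0 h01 by (intro T_nonneg) simp_all
        have rest: "(\<lambda>x. g n x - g n x * h K x) \<in> Lip_c A" for n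
          by (intro Lip_c_diff gL gh)
        have rest0: "0 \<le> g n x - g n x * h K x" for n x
          using mult_left_mono[OF h01(2) g0, of n x K x] by simp
        have le: "outer (E \<inter> C) \<le> (\<Sum>n. ennreal (T (\<lambda>x. g n x - g n x * h K x)))"
          using g rest rest0 by (intro outer_le) (simp add: covers_def hC)
        have inner: "(\<Sum>k<K. \<Sum>n. ennreal (T (d k n))) = (\<Sum>n. ennreal (T (\<lambda>x. g n x * h K x)))"
        proof -
          have "(\<Sum>k<K. ennreal (T (d k n))) = ennreal (T (\<lambda>x. g n x * h K x))" for n
          proof -
            have "(\<Sum>k<K. ennreal (T (d k n))) = ennreal (\<Sum>k<K. T (d k n))"
              using T_nonneg[OF dL d0] by simp
            also have "(\<Sum>k<K. T (d k n)) = T (\<lambda>x. g n x * h K x) - T (\<lambda>x. g n x * h 0 x)"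
              unfolding T_d by (rule sum_lessThan_telescope)
            finally show ?thesis by (simp add: h_def T_zero)
          qed
          then show ?thesis by (subst suminf_sum[symmetric]) simp_all
        qed
        have split: "(\<Sum>n. ennreal (T (\<lambda>x. g n x - g n x * h K x))) + (\<Sum>n. ennreal (T (\<lambda>x. g n x * h K x)))
            = (\<Sum>n. ennreal (T (g n)))"
        proof -
          have eq: "ennreal (T (\<lambda>x. g n x - g n x * h K x)) + ennreal (T (\<lambda>x. g n x * h K x)) = ennreal (T (g n))" for n
            using gh0[of n K] T_nonneg[OF rest rest0, of n]
            by (simp add: T_diff gL gh flip: ennreal_plus)
          show ?thesis
            by (simp only: suminf_add[OF summableI summableI] eq)
        qed
        show ?thesis
          unfolding inner split[symmetric] by (rule add_right_mono[OF le])
      qed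
      then show "\<exists>N. \<forall>K\<ge>N. outer (E \<inter> C) + (\<Sum>k<K. \<Sum>n. ennreal (T (d k n))) \<le> (\<Sum>n. ennreal (T (g n)))"
        by blast
    qed
    ultimately show "outer (E \<inter> C) + outer (E - C) \<le> (\<Sum>n. ennreal (T (g n)))"
      by (meson add_left_mono order.trans)
  qed
qed

text \<open>By \<open>outer_split_closed\<close> the Caratheodory sigma-algebra contains the closed
  sets, which generate the Borel sets.\<close>

lemma outer_measure_space_borel: "measure_space UNIV (sets borel) outer"
proof -
  let ?L = "lambda_system UNIV (Pow UNIV) outer"
  have L: "measure_space UNIV ?L outer"
    by (rule sigma_algebra.caratheodory_lemma[OF sigma_algebra_Pow outer_measure_space_outer])
  then have sa: "sigma_algebra UNIV ?L"
    by (simp add: measure_space_def)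
  have "outer (E \<inter> C) + outer (E - C) = outer E" if "closed C" for E C
  proof (rule antisym[OF outer_split_closed[OF that]])
    have "countably_subadditive (Pow UNIV) outer" "positive (Pow UNIV) outer"
      using outer_measure_space_outer by (auto simp: outer_measure_space_def)
    then have "subadditive (Pow UNIV) outer"
      by (intro ring_of_sets.countably_subadditive_subadditive[OF ring_of_sets_Pow])
    then have "outer ((E \<inter> C) \<union> (E - C)) \<le> outer (E \<inter> C) + outer (E - C)"
      by (rule subadditiveD) auto
    then show "outer E \<le> outer (E \<inter> C) + outer (E - C)"
      by (simp add: Un_Diff_Int Int_Diff_Un)
  qed
  then have "Collect closed \<subseteq> ?L"
    unfolding algebra.lambda_system_eq[OF algebra_Pow] by auto
  then have "sets borel \<subseteq> ?L"
    unfolding borel_eq_closed using sigma_algebra.sigma_sets_subset[OF sa] by simp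
  then show ?thesis
    using sets.sigma_algebra_axioms[of "borel :: 'a measure"] by (intro measure_down[OF L]) simp_all
qed

lemma outer_Un_disjoint:
  assumes "E \<in> sets borel" "F \<in> sets borel" "E \<inter> F = {}"
  shows "outer (E \<union> F) = outer E + outer F"
proof -
  have "emeasure (measure_of UNIV (sets borel) outer) S = outer S" if "S \<in> sets borel" for S
    using outer_measure_space_borel that
    by (intro emeasure_measure_of_sigma) (auto simp: measure_space_def)
  with plus_emeasure[of E "measure_of UNIV (sets borel) outer" F] assms show ?thesis
    by simp
qed

section \<open>The representing measure\<close>

text \<open>If \<open>X\<close> is not \<open>\<sigma>\<close>-compact, then \<open>outer\<close> itself need not be tight (it is \<open>\<infinity>\<close> on sets without
  a countable cover), whence the supremum over compact sets.\<close>

definition rep_measure :: "'a measure" where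
  "rep_measure = measure_of UNIV (sets borel)
     (\<lambda>E. SUP K\<in>{K. compact K \<and> K \<inter> A = {}}. outer (E \<inter> K))"

lemma sets_rep_measure [simp, measurable_cong]: "sets rep_measure = sets borel"
  using sets.sigma_sets_eq[of "borel :: 'a measure"] by (simp add: rep_measure_def)

text \<open>Countable additivity survives the supremum: the compact sets involved are directed under
  union, so supremum and series can be interchanged.\<close>

lemma emeasure_rep_measure:
  assumes "E \<in> sets borel"
  shows "emeasure rep_measure E = (SUP K\<in>{K. compact K \<and> K \<inter> A = {}}. outer (E \<inter> K))"
  unfolding rep_measure_def
proof (rule emeasure_measure_of_sigma)
  let ?I = "{K. compact K \<and> K \<inter> A = {}}"
  let ?\<mu> = "\<lambda>E. SUP K\<in>?I. outer (E \<inter> K)"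
  show "sigma_algebra UNIV (sets (borel :: 'a measure))"
    using sets.sigma_algebra_axioms[of "borel :: 'a measure"] by simp
  have "?I \<noteq> {}" using compact_empty by blast
  then show "positive (sets borel) ?\<mu>"
    by (simp add: positive_def outer_empty)
  have ca: "countably_additive (sets borel) outer"
    using outer_measure_space_borel by (simp add: measure_space_def)
  show "countably_additive (sets borel) ?\<mu>"
  proof (rule countably_additiveI)
    fix F :: "nat \<Rightarrow> 'a set"
    assume F: "range F \<subseteq> sets borel" "disjoint_family F"
    have "(\<Sum>i. ?\<mu> (F i)) = (SUP K\<in>?I. \<Sum>i. outer (F i \<inter> K))"
    proof (rule ennreal_suminf_SUP_eq_directed)
      fix N :: "nat set" and K L assume "K \<in> ?I" "L \<in> ?I"
      then have "K \<union> L \<in> ?I" by auto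
      then show "\<exists>J\<in>?I. \<forall>n\<in>N. outer (F n \<inter> K) \<le> outer (F n \<inter> J) \<and> outer (F n \<inter> L) \<le> outer (F n \<inter> J)"
        by (rule bexI[rotated]) (auto intro: outer_mono)
    qed
    also have "\<dots> = ?\<mu> (\<Union>i. F i)"
    proof (rule SUP_cong)
      fix K assume "K \<in> ?I"
      then have "K \<in> sets borel" by (auto intro: borel_closed compact_imp_closed)
      with F have "(\<Sum>i. outer (F i \<inter> K)) = outer (\<Union>i. F i \<inter> K)"
        by (intro ca[unfolded countably_additive_def, rule_format]) (auto simp: disjoint_family_on_def)
      then show "(\<Sum>i. outer (F i \<inter> K)) = outer ((\<Union>i. F i) \<inter> K)"
        by simp
    qed simp
    finally show "(\<Sum>i. ?\<mu> (F i)) = ?\<mu> (\<Union>i. F i)" .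
  qed
qed fact

text \<open>The supremum is attained at any admissible \<open>K\<close> containing
  \<open>E\<close>.\<close>

lemma emeasure_rep_measure_eq_outer:
  assumes E: "E \<in> sets borel" "E \<subseteq> K" and K: "compact K" "K \<inter> A = {}"
  shows "emeasure rep_measure E = outer E"
  unfolding emeasure_rep_measure[OF E(1)]
proof (rule antisym)
  show "(SUP K\<in>{K. compact K \<and> K \<inter> A = {}}. outer (E \<inter> K)) \<le> outer E"
    by (intro SUP_least outer_mono) auto
  show "outer E \<le> (SUP K\<in>{K. compact K \<and> K \<inter> A = {}}. outer (E \<inter> K))"
    using K E(2) by (intro SUP_upper2[of K]) (auto simp: Int_absorb2)
qed

text \<open>A bump equal to 1 on \<open>K\<close> is a cover by one function.\<close>

lemma outer_compact_finite:
  assumes "compact K" "K \<inter> A = {}"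
  shows "outer K < \<infinity>"
proof (cases "K = {}")
  case False
  then obtain k where k: "\<And>n::nat. (\<lambda>x. max 0 (1 - (k + real n) * infdist x K)) \<in> Lip_c A"
    using Lip_c_bump[OF locally_compact closed_A assms(1) _ assms(2)] by metis
  have "outer K \<le> ennreal (T (\<lambda>x. max 0 (1 - (k + real 0) * infdist x K)))"
    by (rule outer_le_T[OF k]) auto
  then show ?thesis
    by (simp add: le_less_trans[OF _ ennreal_less_top] infinity_ennreal_def)
qed (simp add: outer_empty)

text \<open>\<open>f\<close> is cut into the layers \<open>\<phi> k = min (max 0 (f - k s)) s\<close>. Both \<open>T (\<phi> (k + 1))\<close> and
  the integral of \<open>\<phi> (k + 1)\<close> are at most \<open>s\<close> times the measure of \<open>{x. (k + 1) s < f x}\<close>, which in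
  turn is at most \<open>T (\<phi> k)\<close> and the integral of \<open>\<phi> k\<close>. Summation over \<open>k\<close> compares \<open>T\<close> and the
  integral at \<open>f\<close> and \<open>max 0 (f - s)\<close>.\<close>

lemma nn_integral_shift_bounds:
  assumes f: "f \<in> Lip_c A" "\<And>x. 0 \<le> f x" and s: "0 < s"
  shows "ennreal (T (\<lambda>x. max 0 (f x - s))) \<le> (\<integral>\<^sup>+x. ennreal (f x) \<partial>rep_measure)"
    and "(\<integral>\<^sup>+x. ennreal (max 0 (f x - s)) \<partial>rep_measure) \<le> ennreal (T f)"
proof -
  define \<phi> where "\<phi> k x = min (max 0 (f x - real k * s)) s" for k x
  define E where "E k = {x. real (Suc k) * s < f x}" for k
  obtain B where B: "\<And>x. \<bar>f x\<bar> \<le> B" using f(1) Lip_c_bounded by blast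
  \<comment> \<open>Enough layers to exceed the bound of \<open>f\<close>, so that truncation loses
    nothing.\<close>
  obtain N :: nat where "B < real N * s" using s reals_Archimedean3 by blast
  then have N: "f x \<le> real N * s" for x using B[of x] by linarith
  have "(\<lambda>x. min (max 0 (f x - p)) s) \<in> Lip_c A" if "0 \<le> p" for p
    using that s by (intro Lip_c_compose[OF f(1)]) (auto simp: min_def max_def)
  then have \<phi>_L: "\<phi> k \<in> Lip_c A" for k
    using s by (simp add: \<phi>_def[abs_def])
  have \<phi>_0: "0 \<le> \<phi> k x" and \<phi>_s: "\<phi> k x \<le> s" for k x
    using s by (simp_all add: \<phi>_def)
  have [measurable]: "\<phi> k \<in> borel_measurable borel" "f \<in> borel_measurable borel" for k
    using \<phi>_L f(1) by (auto intro: Lip_c_borel_measurable)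
  have E: "E k \<in> sets borel" for k
    unfolding E_def by measurable
  have \<phi>_in: "\<phi> k x = s" if "x \<in> E k" for k x
    using that s by (auto simp: \<phi>_def E_def algebra_simps)
  have \<phi>_out: "\<phi> (Suc k) x = 0" if "x \<notin> E k" for k x
    using that s by (auto simp: \<phi>_def E_def)
  have sum_\<phi>: "(\<Sum>k<N. \<phi> k x) = f x" for x
    using sum_min_layers[of s "f x" N] s f(2)[of x] N[of x] by (simp add: \<phi>_def)
  have sum_\<phi>_Suc: "(\<Sum>k<N. \<phi> (Suc k) x) = max 0 (f x - s)" for x
    using sum_min_layers[of s "f x - s" N] s N[of x] by (simp add: \<phi>_def algebra_simps)
  \<comment> \<open>\<open>E k\<close> lies in a closed superlevel set at a positive height; this
    set is compact and misses \<open>A\<close>, so both set functions agree on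
    \<open>E k\<close>.\<close>
  have emeasure_E: "emeasure rep_measure (E k) = outer (E k)" for k
  proof (rule emeasure_rep_measure_eq_outer[OF E])
    let ?K = "{x. real (Suc k) * s \<le> f x}"
    have pos: "0 < real (Suc k) * s" using s by simp
    have "closed ?K"
      by (intro closed_Collect_le continuous_intros Lip_c_continuous[OF f(1)])
    moreover have "?K \<subseteq> {x. f x \<noteq> 0}" using pos by auto
    ultimately show "compact ?K"
      using f(1) compact_closure_subset[of "{x. f x \<noteq> 0}" ?K] by (simp add: Lip_c_def)
    show "?K \<inter> A = {}" using pos Lip_c_zero_on[OF f(1)] by fastforce
  qed (auto simp: E_def)
  have T_up: "ennreal (T (\<phi> (Suc k))) \<le> ennreal s * outer (E k)" for k
  proof -
    have "ennreal (T (\<lambda>x. (1 / s) * \<phi> (Suc k) x)) \<le> outer (E k)"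
      using \<phi>_s \<phi>_out s by (intro T_le_outer Lip_c_cmult \<phi>_L) (simp_all add: field_simps)
    then have "ennreal s * ennreal (1 / s * T (\<phi> (Suc k))) \<le> ennreal s * outer (E k)"
      unfolding T_cmult[OF \<phi>_L] by (rule mult_left_mono) simp
    with s show ?thesis
      by (simp flip: ennreal_mult')
  qed
  have T_low: "ennreal s * outer (E k) \<le> ennreal (T (\<phi> k))" for k
  proof -
    have "outer (E k) \<le> ennreal (T (\<lambda>x. (1 / s) * \<phi> k x))"
      using \<phi>_0 \<phi>_in s by (intro outer_le_T Lip_c_cmult \<phi>_L) simp_all
    then have "ennreal s * outer (E k) \<le> ennreal s * ennreal (1 / s * T (\<phi> k))"
      unfolding T_cmult[OF \<phi>_L] by (rule mult_left_mono) simp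
    with s show ?thesis
      by (simp flip: ennreal_mult')
  qed
  have I_up: "(\<integral>\<^sup>+x. ennreal (\<phi> (Suc k) x) \<partial>rep_measure) \<le> ennreal s * outer (E k)" for k
  proof -
    have "(\<integral>\<^sup>+x. ennreal (\<phi> (Suc k) x) \<partial>rep_measure) \<le> (\<integral>\<^sup>+x. ennreal s * indicator (E k) x \<partial>rep_measure)"
      using \<phi>_s \<phi>_out by (intro nn_integral_mono) (auto simp: indicator_def ennreal_leI)
    also have "\<dots> = ennreal s * outer (E k)"
      using E by (simp add: nn_integral_cmult_indicator emeasure_E)
    finally show ?thesis .
  qed
  have I_low: "ennreal s * outer (E k) \<le> (\<integral>\<^sup>+x. ennreal (\<phi> k x) \<partial>rep_measure)" for k
  proof -
    have "ennreal s * outer (E k) = (\<integral>\<^sup>+x. ennreal s * indicator (E k) x \<partial>rep_measure)"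
      using E by (simp add: nn_integral_cmult_indicator emeasure_E)
    also have "\<dots> \<le> (\<integral>\<^sup>+x. ennreal (\<phi> k x) \<partial>rep_measure)"
      using \<phi>_in by (intro nn_integral_mono) (auto simp: indicator_def)
    finally show ?thesis .
  qed
  have T_sum_\<phi>: "ennreal (T (\<lambda>x. \<Sum>k<N. \<phi> (j k) x)) = (\<Sum>k<N. ennreal (T (\<phi> (j k))))" for j
    using T_nonneg[OF \<phi>_L \<phi>_0] by (simp add: T_sum[OF \<phi>_L])
  have I_sum_\<phi>: "(\<integral>\<^sup>+x. ennreal (\<Sum>k<N. \<phi> (j k) x) \<partial>rep_measure) =
      (\<Sum>k<N. \<integral>\<^sup>+x. ennreal (\<phi> (j k) x) \<partial>rep_measure)" for j
  proof -
    have "ennreal (\<Sum>k<N. \<phi> (j k) x) = (\<Sum>k<N. ennreal (\<phi> (j k) x))" for x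
      using \<phi>_0 by simp
    then show ?thesis by (simp add: nn_integral_sum)
  qed
  have "(\<Sum>k<N. ennreal (T (\<phi> (Suc k)))) \<le> (\<Sum>k<N. \<integral>\<^sup>+x. ennreal (\<phi> k x) \<partial>rep_measure)"
    by (intro sum_mono order_trans[OF T_up I_low])
  then show "ennreal (T (\<lambda>x. max 0 (f x - s))) \<le> (\<integral>\<^sup>+x. ennreal (f x) \<partial>rep_measure)"
    using T_sum_\<phi>[of Suc] I_sum_\<phi>[of "\<lambda>k. k"] unfolding sum_\<phi> sum_\<phi>_Suc by (simp only:)
  have "(\<Sum>k<N. \<integral>\<^sup>+x. ennreal (\<phi> (Suc k) x) \<partial>rep_measure) \<le> (\<Sum>k<N. ennreal (T (\<phi> k)))"
    by (intro sum_mono order_trans[OF I_up T_low])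
  then show "(\<integral>\<^sup>+x. ennreal (max 0 (f x - s)) \<partial>rep_measure) \<le> ennreal (T f)"
    using T_sum_\<phi>[of "\<lambda>k. k"] I_sum_\<phi>[of Suc] unfolding sum_\<phi> sum_\<phi>_Suc by (simp only:)
qed

text \<open>Let \<open>s\<close> tend to 0 in \<open>nn_integral_shift_bounds\<close>:
  \<open>T\<close> converges by order continuity, the integral by monotone convergence.\<close>

lemma nn_integral_rep_measure:
  assumes f: "f \<in> Lip_c A" "\<And>x. 0 \<le> f x"
  shows "(\<integral>\<^sup>+x. ennreal (f x) \<partial>rep_measure) = ennreal (T f)"
proof (rule antisym)
  define s where "s n = inverse (real (Suc n))" for n
  have s0: "0 < s n" for n by (simp add: s_def)
  have s_lim: "s \<longlonglongrightarrow> 0" unfolding s_def by (rule LIMSEQ_inverse_real_of_nat)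
  have s_dec: "s (Suc n) \<le> s n" for n by (simp add: s_def)
  define u where "u n x = max 0 (f x - s n)" for n x
  have u: "u n \<in> Lip_c A" for n
    unfolding u_def using s0[of n] by (intro Lip_c_compose[OF f(1)]) (auto simp: max_def)
  have u_lim: "(\<lambda>n. u n x) \<longlonglongrightarrow> f x" for x
  proof -
    have "(\<lambda>n. max 0 (f x - s n)) \<longlonglongrightarrow> max 0 (f x - 0)"
      by (intro tendsto_intros s_lim)
    with f(2)[of x] show ?thesis by (simp add: u_def)
  qed
  have "(\<lambda>n. T (\<lambda>x. f x - u n x)) \<longlonglongrightarrow> 0"
  proof (rule T_tendsto_zero)
    show "(\<lambda>x. f x - u n x) \<in> Lip_c A" for n
      by (intro Lip_c_diff f u)
    show "f x - u (Suc n) x \<le> f x - u n x" for n x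
      using s_dec[of n] by (auto simp: u_def)
    show "(\<lambda>n. f x - u n x) \<longlonglongrightarrow> 0" for x
      using tendsto_diff[OF tendsto_const[of "f x"] u_lim[of x]] by simp
  qed
  from tendsto_diff[OF tendsto_const[of "T f"] this] have "(\<lambda>n. T (u n)) \<longlonglongrightarrow> T f"
    by (simp add: T_diff f u)
  then show "ennreal (T f) \<le> (\<integral>\<^sup>+x. ennreal (f x) \<partial>rep_measure)"
    using nn_integral_shift_bounds(1)[OF f s0]
    by (intro LIMSEQ_le_const2[OF tendsto_ennrealI]) (auto simp: u_def[abs_def])
  have "(\<lambda>n. \<integral>\<^sup>+x. ennreal (u n x) \<partial>rep_measure) \<longlonglongrightarrow> (\<integral>\<^sup>+x. ennreal (f x) \<partial>rep_measure)"
  proof (rule nn_integral_LIMSEQ)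
    show "incseq (\<lambda>n x. ennreal (u n x))"
      by (rule incseq_SucI) (auto simp: le_fun_def u_def intro!: ennreal_leI max.coboundedI2 diff_left_mono s_dec)
    show "(\<lambda>x. ennreal (u n x)) \<in> borel_measurable rep_measure" for n
      using Lip_c_borel_measurable[OF u] by measurable
  qed (intro tendsto_ennrealI u_lim)
  then show "(\<integral>\<^sup>+x. ennreal (f x) \<partial>rep_measure) \<le> ennreal (T f)"
    using nn_integral_shift_bounds(2)[OF f s0]
    by (intro LIMSEQ_le_const2[of _ "\<integral>\<^sup>+x. ennreal (f x) \<partial>rep_measure"]) (auto simp: u_def)
qed

lemma integral_rep_measure:
  assumes f: "f \<in> Lip_c A"
  shows "(\<integral>x. f x \<partial>rep_measure) = T f"
proof -
  let ?p = "\<lambda>x. max 0 (f x)" and ?n = "\<lambda>x. max 0 (- f x)"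
  have p: "?p \<in> Lip_c A" and n: "?n \<in> Lip_c A" and a: "(\<lambda>x. \<bar>f x\<bar>) \<in> Lip_c A"
    by (auto intro!: Lip_c_compose[OF f])
  have "integrable rep_measure f"
    using nn_integral_rep_measure[OF a] Lip_c_borel_measurable[OF f]
    by (simp add: integrable_iff_bounded measurable_cong_sets[OF sets_rep_measure refl])
  then have "(\<integral>x. f x \<partial>rep_measure) = enn2real (\<integral>\<^sup>+x. ennreal (?p x) \<partial>rep_measure)
      - enn2real (\<integral>\<^sup>+x. ennreal (?n x) \<partial>rep_measure)"
    by (simp add: real_lebesgue_integral_def ennreal_max_0)
  also have "\<dots> = T ?p - T ?n"
    using nn_integral_rep_measure[OF p] nn_integral_rep_measure[OF n] T_nonneg[OF p] T_nonneg[OF n]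
    by simp
  also have "\<dots> = T (\<lambda>x. ?p x - ?n x)"
    by (simp only: T_diff[OF p n])
  also have "(\<lambda>x. ?p x - ?n x) = f"
    by (auto simp: fun_eq_iff max_def)
  finally show ?thesis .
qed

text \<open>Outer regularity is built into \<open>outer\<close>: for a cover \<open>g\<close> of \<open>K - E\<close> and \<open>r > 1\<close>, the set of
  \<open>x \<in> K\<close> at which all partial sums of \<open>r g\<close> are at most \<open>1\<close> is a compact subset of \<open>E\<close>, and
  \<open>r g\<close> covers the rest of \<open>K\<close>.\<close>

lemma outer_inner_regular:
  assumes E: "E \<in> sets borel" and K: "compact K" "K \<inter> A = {}"
  shows "outer (E \<inter> K) \<le> (SUP C\<in>{C. compact C \<and> C \<subseteq> E \<inter> K}. outer C)" (is "_ \<le> ?s")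
proof -
  have Kb: "K \<in> sets borel" using K(1) by (intro borel_closed compact_imp_closed)
  have K_le: "outer K \<le> ?s + (\<Sum>n. ennreal (T (g n)))" if g: "g \<in> covers (K - E)" for g
  proof (rule ennreal_le_add_cmultI)
    fix r :: real assume r: "1 < r"
    have gL: "g n \<in> Lip_c A" and g0: "0 \<le> g n x" for n x
      using g by (auto simp: covers_def)
    define S where "S N x = (\<Sum>n<N. r * g n x)" for N x
    define C where "C = K \<inter> {x. \<forall>N. S N x \<le> 1}"
    have rg0: "0 \<le> r * g n x" for n x
      using r g0 by simp
    have sum_S: "(\<Sum>n<N. ennreal (r * g n x)) = ennreal (S N x)" for N x
      unfolding S_def by (rule sum_ennreal) (rule rg0)
    have ennS: "ennreal (S N x) \<le> (\<Sum>n. ennreal (r * g n x))" for N x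
      unfolding sum_S[symmetric] by (rule sum_le_suminf[OF summableI]) simp_all
    have "closed {x. S N x \<le> 1}" for N
      unfolding S_def by (intro closed_Collect_le continuous_intros Lip_c_continuous[OF gL])
    then have C: "compact C"
      unfolding C_def by (intro compact_Int_closed K(1) closed_Collect_all) simp
    \<comment> \<open>On \<open>K - E\<close> the series of \<open>r * g\<close> is at least
      \<open>r > 1\<close>, on \<open>C\<close> at most 1; this is why \<open>r\<close> must exceed
      1 strictly.\<close>
    have "x \<in> E" if x: "x \<in> C" for x
    proof (rule ccontr)
      assume "x \<notin> E"
      with x K(2) have "x \<in> (K - E) - A" unfolding C_def by blast
      with g have "1 \<le> (\<Sum>n. ennreal (g n x))" unfolding covers_def by blast
      then have "ennreal r * 1 \<le> ennreal r * (\<Sum>n. ennreal (g n x))"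
        by (rule mult_left_mono) simp
      also have "\<dots> = (\<Sum>n. ennreal (r * g n x))"
        using r g0 by (simp add: ennreal_mult)
      also have "\<dots> \<le> 1"
      proof (rule suminf_le_const)
        show "(\<Sum>n<N. ennreal (r * g n x)) \<le> 1" for N
          using x by (simp add: sum_S C_def)
      qed (rule summableI)
      finally show False using r by simp
    qed
    then have CE: "C \<subseteq> E \<inter> K" by (auto simp: C_def)
    have Cb: "C \<in> sets borel" using C by (intro borel_closed compact_imp_closed)
    have "(\<lambda>n x. r * g n x) \<in> covers (K - C)"
      unfolding covers_def
    proof safe
      show "(\<lambda>x. r * g n x) \<in> Lip_c A" for n by (intro Lip_c_cmult gL)
      show "0 \<le> r * g n x" for n x by (rule rg0)
      fix x assume "x \<in> K" "x \<notin> C"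
      then obtain N where "1 < S N x" by (auto simp: C_def not_le)
      then have "1 \<le> ennreal (S N x)" by simp
      also note ennS
      finally show "1 \<le> (\<Sum>n. ennreal (r * g n x))" .
    qed
    from outer_le[OF this] have "outer (K - C) \<le> (\<Sum>n. ennreal (r * T (g n)))"
      by (simp add: T_cmult gL)
    also have "\<dots> = ennreal r * (\<Sum>n. ennreal (T (g n)))"
      using r T_nonneg[OF gL g0] by (simp add: ennreal_mult)
    finally have le: "outer (K - C) \<le> ennreal r * (\<Sum>n. ennreal (T (g n)))" .
    have "outer K = outer (C \<union> (K - C))"
      using CE by (intro arg_cong[where f=outer]) auto
    also have "\<dots> = outer C + outer (K - C)"
      using Kb Cb by (intro outer_Un_disjoint) auto
    also have "\<dots> \<le> ?s + ennreal r * (\<Sum>n. ennreal (T (g n)))"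
      using C CE by (intro add_mono le SUP_upper) simp
    finally show "outer K \<le> ?s + ennreal r * (\<Sum>n. ennreal (T (g n)))" .
  qed
  have fin: "outer K < \<infinity>" by (rule outer_compact_finite[OF K])
  then have fin': "outer (K - E) < \<infinity>"
    using outer_mono[of "K - E" K] by (auto intro: le_less_trans)
  \<comment> \<open>Moving \<open>?s\<close> to the left allows the infimum over all covers in
    \<open>K_le\<close>; finiteness of \<open>outer K\<close> justifies the subtraction.\<close>
  have "outer K - ?s \<le> outer (K - E)"
    unfolding outer_def[of "K - E"] using K_le fin
    by (intro INF_greatest) (auto simp: ennreal_minus_le_iff)
  then have "outer K \<le> ?s + outer (K - E)"
    by (simp add: ennreal_minus_le_iff)
  moreover have "outer K = outer (E \<inter> K) + outer (K - E)"
  proof -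
    have "outer K = outer ((E \<inter> K) \<union> (K - E))"
      by (intro arg_cong[where f=outer]) auto
    also have "\<dots> = outer (E \<inter> K) + outer (K - E)"
      using E Kb by (intro outer_Un_disjoint) auto
    finally show ?thesis .
  qed
  ultimately show ?thesis
    using fin' by (auto simp: add.commute[of _ "outer (K - E)"] ennreal_add_left_cancel_le)
qed

text \<open>Each \<open>outer (E \<inter> K)\<close> in the supremum is approximated by compact
  subsets, on which \<open>outer\<close> and \<open>rep_measure\<close> agree.\<close>

lemma rep_measure_inner_regular:
  assumes E: "E \<in> sets borel" "E \<subseteq> - A"
  shows "emeasure rep_measure E = (SUP K\<in>{K. compact K \<and> K \<subseteq> E}. emeasure rep_measure K)"
proof (rule antisym)
  have "outer (E \<inter> K) \<le> (SUP C\<in>{C. compact C \<and> C \<subseteq> E}. emeasure rep_measure C)"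
    if K: "compact K" "K \<inter> A = {}" for K
  proof (rule order_trans[OF outer_inner_regular[OF E(1) K]], rule SUP_least)
    fix C assume "C \<in> {C. compact C \<and> C \<subseteq> E \<inter> K}"
    then have C: "compact C" "C \<subseteq> E" "C \<subseteq> K" by auto
    then have "outer C = emeasure rep_measure C"
      using K by (intro emeasure_rep_measure_eq_outer[symmetric, of C K])
        (auto intro: borel_closed compact_imp_closed)
    with C show "outer C \<le> (SUP C\<in>{C. compact C \<and> C \<subseteq> E}. emeasure rep_measure C)"
      by (auto intro: SUP_upper2)
  qed
  then show "emeasure rep_measure E \<le> (SUP K\<in>{K. compact K \<and> K \<subseteq> E}. emeasure rep_measure K)"
    unfolding emeasure_rep_measure[OF E(1)] by (auto intro: SUP_least)
  show "(SUP K\<in>{K. compact K \<and> K \<subseteq> E}. emeasure rep_measure K) \<le> emeasure rep_measure E"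
    using E(1) by (intro SUP_least emeasure_mono) auto
qed

section \<open>Local 1-finiteness and the relative class\<close>

text \<open>Used to bound the integral of the distance to \<open>A\<close> near \<open>p\<close> by
  \<open>T f\<close>. The function is the minimum of that distance and a tall compactly supported
  bump.\<close>

lemma Lip_c_eq_infdist_near:
  obtains U f where "open U" "p \<in> U" "f \<in> Lip_c A" "\<And>x. 0 \<le> f x" "\<And>x. x \<in> U \<Longrightarrow> f x = infdist x A"
proof -
  \<comment> \<open>The bump is taken relative to \<open>{}\<close> because \<open>p\<close> may lie
    in \<open>A\<close>; vanishing on \<open>A\<close> comes from the minimum with
    \<open>infdist\<close>.\<close>
  obtain k where k: "0 < k" "\<And>n::nat. (\<lambda>x. max 0 (1 - (k + real n) * infdist x {p})) \<in> Lip_c {}"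
    using Lip_c_bump[OF locally_compact closed_empty, of "{p}"] by auto
  define \<phi> where "\<phi> x = max 0 (1 - k * dist x p)" for x
  have "\<phi> \<in> Lip_c {}" using k(2)[of 0] by (simp add: \<phi>_def[abs_def])
  \<comment> \<open>On the ball of radius \<open>1 / (2 * k)\<close> the bump is at least 1/2 and
    the distance to \<open>A\<close> at most \<open>M / 2\<close>.\<close>
  define M where "M = 2 * (infdist p A + 1 / (2 * k))"
  have M: "0 \<le> M" using k(1) by (simp add: M_def infdist_nonneg)
  have M\<phi>: "(\<lambda>x. M * \<phi> x) \<in> Lip_c {}" by (rule Lip_c_cmult) fact
  then obtain L where L: "L-lipschitz_on UNIV (\<lambda>x. M * \<phi> x)" by (rule Lip_c_lipschitz)
  define f where "f x = min (infdist x A) (M * \<phi> x)" for x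
  have "(1 + L)-lipschitz_on UNIV f"
  proof (rule lipschitz_onI)
    show L0: "0 \<le> 1 + L" using lipschitz_on_nonneg[OF L] by simp
    fix x y
    have "\<bar>infdist x A - infdist y A\<bar> \<le> dist x y" by (rule infdist_triangle_abs)
    moreover have "\<bar>M * \<phi> x - M * \<phi> y\<bar> \<le> L * dist x y"
      using lipschitz_onD[OF L, of x y] by (simp add: dist_real_def)
    moreover have "0 \<le> L * dist x y" using lipschitz_on_nonneg[OF L] by simp
    ultimately show "dist (f x) (f y) \<le> (1 + L) * dist x y"
      unfolding f_def dist_real_def distrib_right mult_1 by (smt (verit) zero_le_dist)
  qed
  then have "f \<in> Lip_c {}"
    by (rule Lip_c_dominated[OF M\<phi>]) (auto simp: f_def infdist_nonneg)
  moreover have "f x = 0" if "x \<in> A" for x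
    using that M by (simp add: f_def \<phi>_def)
  ultimately have "f \<in> Lip_c A" by (simp add: Lip_c_def)
  moreover have "0 \<le> f x" for x
    using M by (simp add: f_def \<phi>_def infdist_nonneg)
  moreover have "f x = infdist x A" if x: "x \<in> ball p (1 / (2 * k))" for x
  proof -
    have d: "dist x p < 1 / (2 * k)" using x by (simp add: dist_commute)
    then have "1 / 2 \<le> \<phi> x" using k(1) by (simp add: \<phi>_def field_simps)
    then have "M * (1 / 2) \<le> M * \<phi> x" using M by (rule mult_left_mono)
    moreover have "infdist x A \<le> M * (1 / 2)"
      using infdist_triangle[of x A p] d by (simp add: M_def)
    ultimately show ?thesis by (simp add: f_def)
  qed
  ultimately show ?thesis
    using k(1) by (intro that[of "ball p (1 / (2 * k))" f]) auto
qed

text \<open>Only Borel sets off \<open>A\<close> and functions vanishing on \<open>A\<close> are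
  tested, so \<open>rep_measure\<close> may replace the chosen representative.\<close>

lemma rep_measure_class:
  defines "m \<equiv> rel_measure_rel A `` {rep_measure}"
  shows "m \<in> rel_radon_measures A" "\<And>f. f \<in> Lip_c A \<Longrightarrow> T f = rel_integral m f"
proof -
  have b: "rep_measure \<in> borel_measures" by (simp add: borel_measures_def)
  then have m: "m \<in> rel_borel_measures A"
    unfolding m_def rel_borel_measures_def by (rule quotientI)
  have r: "rep_measure \<in> m"
    unfolding m_def using equiv_rel_measure_rel[OF closed_A] b by (rule equiv_class_self)
  have "rel_tight A m"
    unfolding rel_tight_def
  proof safe
    fix E :: "'a set" assume E: "E \<in> sets borel" "E \<subseteq> - A"
    have "rel_emeasure m K = emeasure rep_measure K" if "compact K" "K \<subseteq> E" for K
      using that E by (intro rel_emeasure_eq[OF closed_A m r]) (auto intro: borel_closed compact_imp_closed)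
    then have "(SUP K\<in>{K. compact K \<and> K \<subseteq> E}. rel_emeasure m K) = (SUP K\<in>{K. compact K \<and> K \<subseteq> E}. emeasure rep_measure K)"
      by (intro SUP_cong) auto
    then show "rel_emeasure m E = (SUP K\<in>{K. compact K \<and> K \<subseteq> E}. rel_emeasure m K)"
      using rel_emeasure_eq[OF closed_A m r E] rep_measure_inner_regular[OF E] by simp
  qed
  moreover have "locally_1_finite A m"
    unfolding locally_1_finite_def
  proof
    fix p
    obtain U f where U: "open U" "p \<in> U" and f: "f \<in> Lip_c A" "\<And>x. 0 \<le> f x"
      and eq: "\<And>x. x \<in> U \<Longrightarrow> f x = infdist x A"
      using Lip_c_eq_infdist_near by blast
    have "rel_nn_integral m (\<lambda>y. ennreal (infdist y A) * indicator (U - A) y) =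
        (\<integral>\<^sup>+y. ennreal (infdist y A) * indicator (U - A) y \<partial>rep_measure)"
      by (rule rel_nn_integral_eq[OF closed_A m r]) simp
    also have "\<dots> \<le> (\<integral>\<^sup>+y. ennreal (f y) \<partial>rep_measure)"
      using eq by (intro nn_integral_mono) (auto simp: indicator_def)
    also have "\<dots> = ennreal (T f)"
      by (rule nn_integral_rep_measure[OF f])
    also have "\<dots> < \<infinity>" by simp
    finally show "\<exists>U. open U \<and> p \<in> U \<and>
        rel_nn_integral m (\<lambda>y. ennreal (infdist y A) * indicator (U - A) y) < \<infinity>"
      using U by blast
  qed
  ultimately show "m \<in> rel_radon_measures A"
    using m by (simp add: rel_radon_measures_def)
  show "T f = rel_integral m f" if f: "f \<in> Lip_c A" for f
    using integral_rep_measure[OF f] rel_integral_eq[OF closed_A m r, of f] Lip_c_zero_on[OF f]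
    by simp
qed

end

section \<open>Uniqueness\<close>

text \<open>The bump functions of \<open>Lip_c_bump\<close> decrease to the indicator of \<open>K\<close>.\<close>

lemma rel_radon_measure_compact:
  fixes A :: "'a::metric_space set"
  assumes lc: "locally_compact_space (euclidean :: 'a topology)" and A: "closed A" "A \<noteq> {}"
    and K: "compact K" "K \<noteq> {}" "K \<inter> A = {}"
  obtains \<phi> :: "nat \<Rightarrow> 'a \<Rightarrow> real" where "\<And>n. \<phi> n \<in> Lip_c A"
    "\<And>m. m \<in> rel_radon_measures A \<Longrightarrow>
      rel_emeasure m K < \<infinity> \<and> (\<lambda>n. rel_integral m (\<phi> n)) \<longlonglongrightarrow> enn2real (rel_emeasure m K)"
proof -
  obtain k where k: "0 < k" "\<And>n::nat. (\<lambda>x. max 0 (1 - (k + real n) * infdist x K)) \<in> Lip_c A"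
    using Lip_c_bump[OF lc A(1) K] by metis
  define \<phi> where "\<phi> n x = max 0 (1 - (k + real n) * infdist x K)" for n x
  have \<phi>: "\<phi> n \<in> Lip_c A" for n using k(2) by (simp add: \<phi>_def[abs_def])
  have cK: "closed K" using K(1) by (rule compact_imp_closed)
  have lim: "(\<lambda>n. \<phi> n x) \<longlonglongrightarrow> indicator K x" for x
  proof (cases "x \<in> K")
    case False
    then have pos: "0 < infdist x K" using cK K(2) infdist_pos_not_in_closed by blast
    then obtain N :: nat where N: "1 < real N * infdist x K"
      using reals_Archimedean3 by blast
    have "\<phi> n x = 0" if "N \<le> n" for n
    proof -
      have "real N * infdist x K \<le> (k + real n) * infdist x K"
        using that pos k(1) by (intro mult_right_mono) auto
      with N show ?thesis by (simp add: \<phi>_def)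
    qed
    with False show ?thesis
      by (intro tendsto_eventually) (auto simp: eventually_sequentially)
  qed (simp add: \<phi>_def)
  \<comment> \<open>The slope is least at \<open>n = 0\<close>, so the integrable function
    \<open>\<phi> 0\<close> dominates all others.\<close>
  have dom: "\<bar>\<phi> n x\<bar> \<le> \<phi> 0 x" for n x
  proof -
    have "k * infdist x K \<le> (k + real n) * infdist x K"
      by (intro mult_right_mono infdist_nonneg) simp
    then show ?thesis by (simp add: \<phi>_def)
  qed
  have "rel_emeasure m K < \<infinity> \<and> (\<lambda>n. rel_integral m (\<phi> n)) \<longlonglongrightarrow> enn2real (rel_emeasure m K)"
    if m: "m \<in> rel_radon_measures A" for m
  proof -
    have int: "integrable (rel_rep m) (\<phi> n)" for n
      using m by (intro integrable_Lip_c[OF A _ _ \<phi>]) (auto simp: rel_radon_measures_def)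
    have "rel_rep m \<in> borel_measures"
    proof -
      obtain \<mu> where "\<mu> \<in> m"
        using m in_quotient_imp_non_empty[OF equiv_rel_measure_rel[OF A(1)]]
        unfolding rel_radon_measures_def rel_borel_measures_def by blast
      then show ?thesis
        using rel_rep_equiv[OF A(1), of m \<mu>] m by (auto simp: rel_radon_measures_def rel_measure_rel_def)
    qed
    then have sets: "sets (rel_rep m) = sets borel" by (simp add: borel_measures_def)
    have Kb: "K \<in> sets (rel_rep m)" using cK by (simp add: sets)
    have ind: "indicator K \<in> borel_measurable (rel_rep m)"
      using Kb by simp
    have meas: "\<phi> n \<in> borel_measurable (rel_rep m)" for n
      using int by (rule borel_measurable_integrable)
    have ae: "AE x in rel_rep m. (\<lambda>n. \<phi> n x) \<longlonglongrightarrow> indicator K x"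
      "AE x in rel_rep m. norm (\<phi> n x) \<le> \<phi> 0 x" for n
      using lim dom by simp_all
    \<comment> \<open>Integrability of the limit is what makes the measure of \<open>K\<close>
      finite.\<close>
    have "integrable (rel_rep m) (indicator K :: 'a \<Rightarrow> real)"
      by (rule integrable_dominated_convergence[OF ind meas int ae])
    then have "emeasure (rel_rep m) K < \<infinity>"
      using Kb by (simp add: integrable_indicator_iff sets.Int_space_eq2)
    moreover have "(\<lambda>n. \<integral>x. \<phi> n x \<partial>(rel_rep m)) \<longlonglongrightarrow> (\<integral>x. indicator K x \<partial>(rel_rep m))"
      by (rule integral_dominated_convergence[OF ind meas int ae])
    then have "(\<lambda>n. \<integral>x. \<phi> n x \<partial>(rel_rep m)) \<longlonglongrightarrow> measure (rel_rep m) K"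
      using Kb by (simp add: sets.Int_space_eq2)
    ultimately show ?thesis
      by (simp add: rel_emeasure_def rel_integral_def measure_def)
  qed
  with \<phi> show ?thesis by (rule that)
qed

text \<open>The integrals determine the measure of compact sets off \<open>A\<close>, tightness
  extends this to Borel sets off \<open>A\<close>, and agreement there is equivalence.\<close>

lemma rel_radon_measures_eqI:
  fixes A :: "'a::metric_space set"
  assumes lc: "locally_compact_space (euclidean :: 'a topology)" and A: "closed A" "A \<noteq> {}"
    and m: "m \<in> rel_radon_measures A" "m' \<in> rel_radon_measures A"
    and eq: "\<And>f. f \<in> Lip_c A \<Longrightarrow> rel_integral m f = rel_integral m' f"
  shows "m = m'"
proof -
  have K: "rel_emeasure m K = rel_emeasure m' K" if K: "compact K" "K \<inter> A = {}" for K
  proof (cases "K = {}")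
    case False
    obtain \<phi> where \<phi>: "\<And>n. \<phi> n \<in> Lip_c A"
      and lim: "\<And>m. m \<in> rel_radon_measures A \<Longrightarrow>
        rel_emeasure m K < \<infinity> \<and> (\<lambda>n. rel_integral m (\<phi> n)) \<longlonglongrightarrow> enn2real (rel_emeasure m K)"
      using rel_radon_measure_compact[OF lc A K(1) False K(2)] by blast
    have "enn2real (rel_emeasure m K) = enn2real (rel_emeasure m' K)"
      using lim[OF m(1)] lim[OF m(2)] by (intro LIMSEQ_unique) (auto simp: eq[OF \<phi>])
    \<comment> \<open>Both values are finite, so \<open>enn2real\<close> loses no
      information.\<close>
    then show ?thesis
      using lim[OF m(1)] lim[OF m(2)] by (metis ennreal_enn2real infinity_ennreal_def)
  qed (simp add: rel_emeasure_def)
  have E: "rel_emeasure m E = rel_emeasure m' E" if "E \<in> sets borel" "E \<subseteq> - A" for E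
  proof -
    have "rel_emeasure m E = (SUP K\<in>{K. compact K \<and> K \<subseteq> E}. rel_emeasure m K)"
      using m(1) that by (auto simp: rel_radon_measures_def rel_tight_def)
    also have "\<dots> = (SUP K\<in>{K. compact K \<and> K \<subseteq> E}. rel_emeasure m' K)"
      using that by (intro SUP_cong refl K) auto
    also have "\<dots> = rel_emeasure m' E"
      using m(2) that by (auto simp: rel_radon_measures_def rel_tight_def)
    finally show ?thesis .
  qed
  have q: "m \<in> borel_measures // rel_measure_rel A" "m' \<in> borel_measures // rel_measure_rel A"
    using m by (auto simp: rel_radon_measures_def rel_borel_measures_def)
  have equiv: "equiv borel_measures (rel_measure_rel A)"
    by (rule equiv_rel_measure_rel[OF A(1)])
  have rep: "rel_rep m \<in> m" "rel_rep m' \<in> m'"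
    using q[THEN in_quotient_imp_non_empty[OF equiv]] by (auto simp: rel_rep_def some_in_eq)
  then have "rel_rep m \<in> borel_measures" "rel_rep m' \<in> borel_measures"
    using q[THEN in_quotient_imp_subset[OF equiv]] by auto
  then have "(rel_rep m, rel_rep m') \<in> rel_measure_rel A"
    using E by (simp add: rel_measure_rel_iff[OF A(1)] rel_emeasure_def)
  then show "m = m'"
    using quotient_eq_iff[OF equiv q rep] by simp
qed

theorem theorem1p1:
  fixes A :: "'a::metric_space set"
    and T :: "('a \<Rightarrow> real) \<Rightarrow> real"
  assumes "closed A" and "A \<noteq> {}"
    and "locally_compact_space (euclidean :: 'a topology)"
    and "linear_functional_on (Lip_c A) T"
    and "positive_functional_on (Lip_c A) T"
    and "seq_order_continuous_on (Lip_c A) T"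
  shows "\<exists>!\<mu>. \<mu> \<in> rel_radon_measures A \<and> (\<forall>f\<in>Lip_c A. T f = rel_integral \<mu> f)"
proof -
  interpret Lip_c_functional A T
    by unfold_locales fact+
  show ?thesis
  proof (rule ex_ex1I)
    show "\<exists>\<mu>. \<mu> \<in> rel_radon_measures A \<and> (\<forall>f\<in>Lip_c A. T f = rel_integral \<mu> f)"
      using rep_measure_class by blast
  next
    fix \<mu> \<nu>
    assume "\<mu> \<in> rel_radon_measures A \<and> (\<forall>f\<in>Lip_c A. T f = rel_integral \<mu> f)"
      and "\<nu> \<in> rel_radon_measures A \<and> (\<forall>f\<in>Lip_c A. T f = rel_integral \<nu> f)"
    then show "\<mu> = \<nu>"
      using assms by (intro rel_radon_measures_eqI[of A]) auto
  qed
qed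

end
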